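(* Consider the two-user IM/DD interference channel in the strong interference regime $h_{12}\ge h_{11}>0$ and $h_{21}\ge h_{22}>0$, with $\alpha_1=\alpha_2=\alpha\in(0,1]$. Let $\mathcal{G}'_{\rm Z}$ be the set of all $(\mathsf{R}_1,\mathsf{R}_2)\in\mathbb{R}_+^2$ such that, for both choices $i,j\in\{1,2\}$, $i\neq j$, $$\mathsf{R}_i\le\overline{\mathsf{C}}(h_{ii}\mathsf{A},\alpha),$$ $$\mathsf{R}_1+\mathsf{R}_2\le\overline{\mathsf{C}}\big((h_{ii}+h_{ji})\mathsf{A},\alpha\big)-\min\Big\{0,\tfrac12\log\Big(\max\Big\{\tfrac{h_{ji}^2}{h_{jj}^2},\ \tfrac{1-h_{ji}^2/h_{jj}^2}{2^{2\overline{\mathsf{C}}(h_{jj}\mathsf{A},\alpha)}}\Big\}\Big)\Big\}.$$ Then, given $(\mathsf{R}_1,\mathsf{R}_2)\in\mathcal{G}'_{\rm Z}$ and $\epsilon>0$, the rate pair $(\mathsf{R}_1-\frac12-\epsilon,\ \mathsf{R}_2-\frac12-\epsilon)$ is achievable (i.e., lies in the capacity region $\mathcal{G}$) when $\frac{\mathsf{A}}{\sigma}$ is sufficiently large.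
   Context: Two-user IM/DD interference channel: for $i,j\in\{1,2\}$, $i\neq j$, at each time instant $Y_i=h_{ii}X_i+h_{ji}X_j+Z_i$, where $h_{kl}\ge0$ are channel gains, $Z_1,Z_2\sim\mathcal{N}(0,\sigma^2)$ ($\sigma>0$), i.i.d. over time and independent of the inputs. Inputs satisfy $X_i\in[0,\mathsf{A}]$ ($\mathsf{A}>0$) and $\mathbb{E}[X_i]\le\alpha_i\mathsf{A}$, $\alpha_i\in(0,1]$. Transmitter $i$ encodes $m_i\in\{1,\dots,\lceil2^{n\mathsf{R}_i}\rceil\}$ into a length-$n$ codeword satisfying these constraints; receiver $i$ decodes $m_i$ from $Y_i^n$; $(\mathsf{R}_1,\mathsf{R}_2)$ is achievable if there are codes with both average error probabilities tending to $0$; the capacity region $\mathcal{G}$ is the closure of the achievable pairs (a pair with a negative coordinate is regarded as achievable when it is componentwise dominated by a point of $\mathcal{G}$). Logarithms are base 2, and $\mathcal{Q}(x)=\int_x^\infty\frac{1}{\sqrt{2\pi}}e^{-t^2/2}dt$. The function $\overline{\mathsf{C}}(\mathsf{A},\alpha)$ (an upper bound on the capacity of the point-to-point channel $Y=X+Z$, $Z\sim\mathcal{N}(0,\sigma^2)$, $X\in[0,\mathsf{A}]$, $\mathbb{E}[X]\le\alpha\mathsf{A}$) is defined as $c_1$ if $\alpha\in(0,\frac12)$ and $c_2$ if $\alpha\in[\frac12,1]$, where $$c_1=\min_{\mu,\xi>0}\Big[1-\mathcal{Q}\big(\tfrac{\xi+\alpha\mathsf{A}}{\sigma}\big)-\m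athcal{Q}\big(\tfrac{\xi+(1-\alpha)\mathsf{A}}{\sigma}\big)\Big]\log\Big(\frac{\mathsf{A}}{\sigma}\frac{e^{\mu\xi/\mathsf{A}}-e^{-\mu(1+\xi/\mathsf{A})}}{\sqrt{2\pi}\,\mu\,(1-2\mathcal{Q}(\xi/\sigma))}\Big)+\log(e)\Big[-\tfrac12+\mathcal{Q}\big(\tfrac{\xi}{\sigma}\big)+\tfrac{\xi}{\sqrt{2\pi}\sigma}e^{-\frac{\xi^2}{2\sigma^2}}+\tfrac{\sigma}{\mathsf{A}}\tfrac{\mu}{\sqrt{2\pi}}\big(e^{-\frac{\xi^2}{2\sigma^2}}-e^{-\frac{(\mathsf{A}+\xi)^2}{2\sigma^2}}\big)+\mu\alpha\big(1-2\mathcal{Q}\big(\tfrac{\xi+\mathsf{A}/2}{\sigma}\big)\big)\Big],$$ $$c_2=\min_{\xi>0}\Big[1-2\mathcal{Q}\big(\tfrac{\xi+\mathsf{A}/2}{\sigma}\big)\Big]\log\Big(\frac{\mathsf{A}+2\xi}{\sigma\sqrt{2\pi}(1-2\mathcal{Q}(\xi/\sigma))}\Big)+\log(e)\Big[-\tfrac12+\mathcal{Q}\big(\tfrac{\xi}{\sigma}\big)+\tfrac{\xi}{\sqrt{2\pi}\sigma}e^{-\frac{\xi^2}{2\sigma^2}}\Big].$$ *)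

theory Defs
  imports "HOL-Probability.Probability"
begin

definition Qfun :: "real \<Rightarrow> real" where
  "Qfun x = (LBINT t:{x<..}. exp (-(t\<^sup>2) / 2) / sqrt (2 * pi))"

definition c1_obj :: "real \<Rightarrow> real \<Rightarrow> real \<Rightarrow> real \<Rightarrow> real \<Rightarrow> real" where
  "c1_obj \<sigma> A \<alpha> \<mu> \<xi> =
     (1 - Qfun ((\<xi> + \<alpha> * A) / \<sigma>) - Qfun ((\<xi> + (1 - \<alpha>) * A) / \<sigma>))
       * log 2 ((A / \<sigma>) * (exp (\<mu> * \<xi> / A) - exp (- \<mu> * (1 + \<xi> / A)))
                 / (sqrt (2 * pi) * \<mu> * (1 - 2 * Qfun (\<xi> / \<sigma>))))
     + log 2 (exp 1) *
       (- 1 / 2 + Qfun (\<xi> / \<sigma>)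
        + \<xi> / (sqrt (2 * pi) * \<sigma>) * exp (- (\<xi>\<^sup>2) / (2 * \<sigma>\<^sup>2))
        + (\<sigma> / A) * (\<mu> / sqrt (2 * pi)) *
            (exp (- (\<xi>\<^sup>2) / (2 * \<sigma>\<^sup>2)) - exp (- ((A + \<xi>)\<^sup>2) / (2 * \<sigma>\<^sup>2)))
        + \<mu> * \<alpha> * (1 - 2 * Qfun ((\<xi> + A / 2) / \<sigma>)))"

definition c2_obj :: "real \<Rightarrow> real \<Rightarrow> real \<Rightarrow> real" where
  "c2_obj \<sigma> A \<xi> =
     (1 - 2 * Qfun ((\<xi> + A / 2) / \<sigma>))
       * log 2 ((A + 2 * \<xi>) / (\<sigma> * sqrt (2 * pi) * (1 - 2 * Qfun (\<xi> / \<sigma>))))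
     + log 2 (exp 1) *
       (- 1 / 2 + Qfun (\<xi> / \<sigma>)
        + \<xi> / (sqrt (2 * pi) * \<sigma>) * exp (- (\<xi>\<^sup>2) / (2 * \<sigma>\<^sup>2)))"

text \<open>Upper bound \<open>\<overline>C(A,\<alpha>)\<close> (noise std sigma); "min" rendered as infimum.\<close>
definition Cbar :: "real \<Rightarrow> real \<Rightarrow> real \<Rightarrow> real" where
  "Cbar \<sigma> A \<alpha> =
     (if \<alpha> < 1 / 2
      then Inf ((\<lambda>(\<mu>, \<xi>). c1_obj \<sigma> A \<alpha> \<mu> \<xi>) ` ({0<..} \<times> {0<..}))
      else Inf (c2_obj \<sigma> A ` {0<..}))"

definition noise :: "nat \<Rightarrow> real \<Rightarrow> (nat \<Rightarrow> real) measure" where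
  "noise n \<sigma> = PiM {..<n} (\<lambda>_. density lborel (normal_density 0 \<sigma>))"

definition num_msgs :: "nat \<Rightarrow> real \<Rightarrow> nat" where
  "num_msgs n R = nat \<lceil>2 powr (real n * R)\<rceil>"

definition valid_enc :: "nat \<Rightarrow> nat \<Rightarrow> real \<Rightarrow> real \<Rightarrow> (nat \<Rightarrow> nat \<Rightarrow> real) \<Rightarrow> bool" where
  "valid_enc n M \<alpha> A x \<longleftrightarrow>
     (\<forall>m\<in>{1..M}. (\<forall>k<n. 0 \<le> x m k \<and> x m k \<le> A) \<and> (\<Sum>k<n. x m k) \<le> real n * \<alpha> * A)"

definition valid_dec :: "nat \<Rightarrow> ((nat \<Rightarrow> real) \<Rightarrow> nat) \<Rightarrow> bool" where
  "valid_dec n g \<longleftrightarrow> g \<in> measurable (PiM {..<n} (\<lambda>_. lborel)) (count_space UNIV)"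

definition avg_err :: "nat \<Rightarrow> real \<Rightarrow> real \<Rightarrow> real \<Rightarrow> (nat \<Rightarrow> nat \<Rightarrow> real) \<Rightarrow>
    (nat \<Rightarrow> nat \<Rightarrow> real) \<Rightarrow> nat \<Rightarrow> nat \<Rightarrow> ((nat \<Rightarrow> real) \<Rightarrow> nat) \<Rightarrow> real" where
  "avg_err n \<sigma> a b xo xi Mo Mi g =
     (\<Sum>m\<in>{1..Mo}. \<Sum>m'\<in>{1..Mi}.
        measure (noise n \<sigma>)
          {z \<in> space (noise n \<sigma>).
             g (restrict (\<lambda>k. a * xo m k + b * xi m' k + z k) {..<n}) \<noteq> m})
     / (real Mo * real Mi)"

definition achievable :: "real \<Rightarrow> real \<Rightarrow> real \<Rightarrow> real \<Rightarrow> real \<Rightarrow> real \<Rightarrow> real \<Rightarrow> real \<Rightarrow>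
    real \<Rightarrow> real \<Rightarrow> bool" where
  "achievable \<sigma> A \<alpha>1 \<alpha>2 h11 h12 h21 h22 R1 R2 \<longleftrightarrow>
     (\<exists>x1 x2 :: nat \<Rightarrow> nat \<Rightarrow> nat \<Rightarrow> real. \<exists>g1 g2 :: nat \<Rightarrow> (nat \<Rightarrow> real) \<Rightarrow> nat.
        (\<forall>n. valid_enc n (num_msgs n R1) \<alpha>1 A (x1 n) \<and> valid_enc n (num_msgs n R2) \<alpha>2 A (x2 n)
             \<and> valid_dec n (g1 n) \<and> valid_dec n (g2 n))
      \<and> (\<lambda>n. avg_err n \<sigma> h11 h21 (x1 n) (x2 n) (num_msgs n R1) (num_msgs n R2) (g1 n))
           \<longlonglongrightarrow> 0
      \<and> (\<lambda>n. avg_err n \<sigma> h22 h12 (x2 n) (x1 n) (num_msgs n R2) (num_msgs n R1) (g2 n))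
           \<longlonglongrightarrow> 0)"

definition cap_region :: "real \<Rightarrow> real \<Rightarrow> real \<Rightarrow> real \<Rightarrow> real \<Rightarrow> real \<Rightarrow> real \<Rightarrow> real \<Rightarrow>
    (real \<times> real) set" where
  "cap_region \<sigma> A \<alpha>1 \<alpha>2 h11 h12 h21 h22 =
     closure {(R1, R2). 0 \<le> R1 \<and> 0 \<le> R2 \<and> achievable \<sigma> A \<alpha>1 \<alpha>2 h11 h12 h21 h22 R1 R2}"

text \<open>A pair (possibly with negative coordinates) is in the region if dominated by a point of it.\<close>
definition in_cap_region :: "real \<Rightarrow> real \<Rightarrow> real \<Rightarrow> real \<Rightarrow> real \<Rightarrow> real \<Rightarrow> real \<Rightarrow> real \<Rightarrow>
    real \<Rightarrow> real \<Rightarrow> bool" where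
  "in_cap_region \<sigma> A \<alpha>1 \<alpha>2 h11 h12 h21 h22 R1 R2 \<longleftrightarrow>
     (\<exists>(a, b) \<in> cap_region \<sigma> A \<alpha>1 \<alpha>2 h11 h12 h21 h22. R1 \<le> a \<and> R2 \<le> b)"

definition sum_bound :: "real \<Rightarrow> real \<Rightarrow> real \<Rightarrow> real \<Rightarrow> real \<Rightarrow> real \<Rightarrow> real" where
  "sum_bound \<sigma> A \<alpha> hii hji hjj =
     Cbar \<sigma> ((hii + hji) * A) \<alpha>
     - min 0 (1 / 2 * log 2 (max (hji\<^sup>2 / hjj\<^sup>2)
                 ((1 - hji\<^sup>2 / hjj\<^sup>2) / 2 powr (2 * Cbar \<sigma> (hjj * A) \<alpha>))))"

definition GZ' :: "real \<Rightarrow> real \<Rightarrow> real \<Rightarrow> real \<Rightarrow> real \<Rightarrow> real \<Rightarrow> real \<Rightarrow> (real \<times> real) set" where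
  "GZ' \<sigma> A \<alpha> h11 h12 h21 h22 =
     {(R1, R2). 0 \<le> R1 \<and> 0 \<le> R2
        \<and> R1 \<le> Cbar \<sigma> (h11 * A) \<alpha> \<and> R2 \<le> Cbar \<sigma> (h22 * A) \<alpha>
        \<and> R1 + R2 \<le> sum_bound \<sigma> A \<alpha> h11 h21 h22
        \<and> R1 + R2 \<le> sum_bound \<sigma> A \<alpha> h22 h12 h11}"

end

theory Submission
  imports Defs "HOL-Real_Asymp.Real_Asymp"
begin

text \<open>The codewords of both users are drawn uniformly from the set \<open>K\<close> of admissible words, and each receiver looks
  for a pair of messages whose noiseless output lies within distance \<open>sqrt (n \<tau>)\<close> of what it received, with
  \<open>\<tau>\<close> slightly above \<open>\<sigma>\<^sup>2\<close>. A wrong pair is accepted with probability at most the volume of that ball divided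
  by \<open>h ^ n\<close> times the volume of \<open>K\<close>, where \<open>h\<close> is the gain of any codeword that is wrong. Hence the union bound
  gives the rates \<open>S h\<close>, where \<open>S h\<close> is the normalised logarithm of that quotient of volumes: \<open>R1 < S h11\<close>,
  \<open>R2 < S h22\<close>, and \<open>R1 + R2\<close> below \<open>S (max h11 h21)\<close> and \<open>S (max h22 h12)\<close>. The volume of \<open>K\<close> grows at the
  rate of the truncated exponential (or uniform) entropy, and this is also what \<open>Cbar\<close> is asymptotically bounded
  by. In the strong interference regime the sum bounds of \<open>GZ'\<close> are the values of \<open>Cbar\<close> at
  \<open>h11 + h21 \<le> 2 * max h11 h21\<close> and \<open>h22 + h12 \<le> 2 * max h22 h12\<close>, so one bit in the sum rate, half a bit per
  user, is all that is lost.\<close>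

subsection \<open>Gaussian integrals\<close>

text \<open>The exponential weight turns the centred Gaussian density of deviation \<sigma> into a
  multiple of the one of deviation \<rho>, whose integral is 1. With the tilt parametrised by
  \<rho>, this is the Chernoff moment for the event that the noise energy exceeds
  \<open>n * \<tau>\<close>.\<close>

lemma nn_integral_gaussian_exp_square:
  fixes \<sigma> \<rho> \<tau> :: real
  assumes "0 < \<sigma>" "\<sigma> < \<rho>"
  shows "(\<integral>\<^sup>+z. ennreal (exp ((1 / \<sigma>\<^sup>2 - 1 / \<rho>\<^sup>2) / 2 * (z\<^sup>2 - \<tau>)))
            \<partial>density lborel (normal_density 0 \<sigma>))
         = ennreal (\<rho> / \<sigma> * exp (- (1 / \<sigma>\<^sup>2 - 1 / \<rho>\<^sup>2) / 2 * \<tau>))"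
proof -
  have \<rho>: "0 < \<rho>" using assms by simp
  have eq: "normal_density 0 \<sigma> z * exp ((1 / \<sigma>\<^sup>2 - 1 / \<rho>\<^sup>2) / 2 * (z\<^sup>2 - \<tau>))
      = (\<rho> / \<sigma> * exp (- (1 / \<sigma>\<^sup>2 - 1 / \<rho>\<^sup>2) / 2 * \<tau>)) * normal_density 0 \<rho> z" for z
  proof -
    have "- z\<^sup>2 / (2 * \<sigma>\<^sup>2) + (1 / \<sigma>\<^sup>2 - 1 / \<rho>\<^sup>2) / 2 * (z\<^sup>2 - \<tau>)
        = - (1 / \<sigma>\<^sup>2 - 1 / \<rho>\<^sup>2) / 2 * \<tau> + - z\<^sup>2 / (2 * \<rho>\<^sup>2)"
      using assms \<rho> by (simp add: field_simps)
    then have "exp (- z\<^sup>2 / (2 * \<sigma>\<^sup>2)) * exp ((1 / \<sigma>\<^sup>2 - 1 / \<rho>\<^sup>2) / 2 * (z\<^sup>2 - \<tau>))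
        = exp (- (1 / \<sigma>\<^sup>2 - 1 / \<rho>\<^sup>2) / 2 * \<tau>) * exp (- z\<^sup>2 / (2 * \<rho>\<^sup>2))"
      by (simp only: exp_add[symmetric])
    then show ?thesis
      using assms \<rho> by (simp add: normal_density_def real_sqrt_mult)
  qed
  have "(\<integral>\<^sup>+z. ennreal (exp ((1 / \<sigma>\<^sup>2 - 1 / \<rho>\<^sup>2) / 2 * (z\<^sup>2 - \<tau>)))
            \<partial>density lborel (normal_density 0 \<sigma>))
     = (\<integral>\<^sup>+z. ennreal (\<rho> / \<sigma> * exp (- (1 / \<sigma>\<^sup>2 - 1 / \<rho>\<^sup>2) / 2 * \<tau>)) * ennreal (normal_density 0 \<rho> z) \<partial>lborel)"
    by (subst nn_integral_density)
       (use \<rho> assms in \<open>auto simp only: ennreal_mult[symmetric] normal_density_nonneg eq exp_ge_zero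
          divide_nonneg_pos mult_nonneg_nonneg less_imp_le intro!: nn_integral_cong\<close>, measurable)
  also have "\<dots> = ennreal (\<rho> / \<sigma> * exp (- (1 / \<sigma>\<^sup>2 - 1 / \<rho>\<^sup>2) / 2 * \<tau>))"
    using \<rho> by (subst nn_integral_cmult) (auto simp: nn_integral_eq_integral)
  finally show ?thesis .
qed

text \<open>The inequality \<open>ln x \<le> x - 1\<close> at
  \<open>x = \<rho>\<^sup>2 / \<sigma>\<^sup>2\<close> bounds twice the logarithm of the prefactor,
  and \<open>\<rho>\<^sup>2 < \<tau>\<close> makes the comparison strict. Hence the probability of
  too large a noise energy decays exponentially in \<open>n\<close>.\<close>

lemma gaussian_exp_square_less_1:
  fixes \<sigma> \<rho> \<tau> :: real
  assumes "0 < \<sigma>" "\<sigma> < \<rho>" "\<rho>\<^sup>2 < \<tau>"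
  shows "\<rho> / \<sigma> * exp (- (1 / \<sigma>\<^sup>2 - 1 / \<rho>\<^sup>2) / 2 * \<tau>) < 1"
proof -
  have \<rho>: "0 < \<rho>" using assms by simp
  have sq: "\<sigma>\<^sup>2 < \<rho>\<^sup>2" using assms by (simp add: power_strict_mono)
  then have pos: "0 < 1 / \<sigma>\<^sup>2 - 1 / \<rho>\<^sup>2" using assms \<rho> by (simp add: field_simps)
  have "2 * ln (\<rho> / \<sigma>) = ln (\<rho>\<^sup>2 / \<sigma>\<^sup>2)"
    using assms \<rho> by (simp add: ln_div ln_realpow)
  also have "\<dots> \<le> \<rho>\<^sup>2 / \<sigma>\<^sup>2 - 1"
    using assms \<rho> by (intro ln_le_minus_one) auto
  also have "\<dots> = (1 / \<sigma>\<^sup>2 - 1 / \<rho>\<^sup>2) * \<rho>\<^sup>2"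
    using assms \<rho> by (simp add: field_simps)
  also have "\<dots> < (1 / \<sigma>\<^sup>2 - 1 / \<rho>\<^sup>2) * \<tau>"
    using pos assms by simp
  finally have "ln (\<rho> / \<sigma>) + - (1 / \<sigma>\<^sup>2 - 1 / \<rho>\<^sup>2) / 2 * \<tau> < 0"
    by (simp add: field_simps)
  moreover have "\<rho> / \<sigma> * exp (- (1 / \<sigma>\<^sup>2 - 1 / \<rho>\<^sup>2) / 2 * \<tau>)
      = exp (ln (\<rho> / \<sigma>) + - (1 / \<sigma>\<^sup>2 - 1 / \<rho>\<^sup>2) / 2 * \<tau>)"
    using assms \<rho> by (subst exp_add) simp
  ultimately show ?thesis by (metis exp_less_one_iff)
qed

text \<open>\<open>hit_weight \<sigma> \<tau> c\<close> is the expectation of the Chernoff weight \<open>exp ((\<tau> - (c + Z)\<^sup>2) / (2 * \<tau>))\<close>; a product of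
  \<open>n\<close> such weights dominates the indicator of a ball of squared radius \<open>n * \<tau>\<close>.\<close>

definition hit_weight :: "real \<Rightarrow> real \<Rightarrow> real \<Rightarrow> real" where
  "hit_weight \<sigma> \<tau> c = sqrt (2 * pi * exp 1 * \<tau>) * normal_density 0 (sqrt (\<tau> + \<sigma>\<^sup>2)) c"

lemma hit_weight_nonneg: "0 \<le> \<tau> \<Longrightarrow> 0 \<le> hit_weight \<sigma> \<tau> c"
  by (simp add: hit_weight_def)

lemma measurable_hit_weight[measurable]: "hit_weight \<sigma> \<tau> \<in> borel_measurable borel"
  unfolding hit_weight_def[abs_def] by measurable

text \<open>Up to a constant the weight is the Gaussian density of variance \<tau> at
  \<open>c + z\<close>. After the reflection of \<open>z\<close> the integral is a convolution of
  two centred Gaussians, so the variances add.\<close>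

lemma nn_integral_gaussian_shifted_exp:
  fixes \<sigma> \<tau> c :: real
  assumes "0 < \<sigma>" "0 < \<tau>"
  shows "(\<integral>\<^sup>+z. ennreal (exp ((\<tau> - (c + z)\<^sup>2) / (2 * \<tau>))) \<partial>density lborel (normal_density 0 \<sigma>))
         = ennreal (hit_weight \<sigma> \<tau> c)"
proof -
  have eq: "exp ((\<tau> - (c + z)\<^sup>2) / (2 * \<tau>)) = sqrt (2 * pi * exp 1 * \<tau>) * normal_density 0 (sqrt \<tau>) (c + z)" for z
  proof -
    have "(\<tau> - (c + z)\<^sup>2) / (2 * \<tau>) = 1 / 2 + - (c + z)\<^sup>2 / (2 * \<tau>)"
      using assms by (simp add: field_simps)
    moreover have "sqrt (exp 1) = exp (1 / 2 :: real)"
      by (rule real_sqrt_unique) (simp_all add: power2_eq_square exp_add[symmetric])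
    ultimately show ?thesis
      using assms by (simp only: exp_add) (simp add: normal_density_def real_sqrt_mult)
  qed
  have "(\<integral>\<^sup>+z. ennreal (exp ((\<tau> - (c + z)\<^sup>2) / (2 * \<tau>))) \<partial>density lborel (normal_density 0 \<sigma>))
      = (\<integral>\<^sup>+z. ennreal (sqrt (2 * pi * exp 1 * \<tau>)) *
             ennreal (normal_density 0 (sqrt \<tau>) (c + z) * normal_density 0 \<sigma> z) \<partial>lborel)"
    unfolding eq
    by (subst nn_integral_density)
       (use assms in \<open>auto simp: ennreal_mult[symmetric] mult_ac intro!: nn_integral_cong\<close>)
  also have "\<dots> = ennreal (sqrt (2 * pi * exp 1 * \<tau>)) *
      (\<integral>\<^sup>+z. ennreal (normal_density 0 (sqrt \<tau>) (c + z) * normal_density 0 \<sigma> z) \<partial>lborel)"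
    by (rule nn_integral_cmult) simp
  also have "(\<integral>\<^sup>+z. ennreal (normal_density 0 (sqrt \<tau>) (c + z) * normal_density 0 \<sigma> z) \<partial>lborel)
     = (\<integral>\<^sup>+z. ennreal (normal_density 0 (sqrt \<tau>) (c - z) * normal_density 0 \<sigma> z) \<partial>lborel)"
    by (subst nn_integral_real_affine[where c="-1" and t=0]) (auto simp: normal_density_def)
  also have "\<dots> = normal_density 0 (sqrt ((sqrt \<tau>)\<^sup>2 + \<sigma>\<^sup>2)) c"
    using fun_cong[OF conv_normal_density_zero_mean[of "sqrt \<tau>" \<sigma>], of c] assms by simp
  finally show ?thesis
    using assms by (simp add: hit_weight_def ennreal_mult)
qed

text \<open>As a function of \<open>y\<close> the weight is a constant times a rescaled and shifted
  probability density. The value depends neither on the shift \<open>c\<close> nor on \<sigma>,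
  which is what allows all other codewords to be frozen later.\<close>

lemma nn_integral_hit_weight:
  fixes \<sigma> \<tau> a c :: real
  assumes "0 < \<tau>" "a \<noteq> 0"
  shows "(\<integral>\<^sup>+y. ennreal (hit_weight \<sigma> \<tau> (c + a * y)) \<partial>lborel) = ennreal (sqrt (2 * pi * exp 1 * \<tau>) / \<bar>a\<bar>)"
proof -
  have pos: "0 < sqrt (\<tau> + \<sigma>\<^sup>2)" using assms by (simp add: add_pos_nonneg)
  have "(\<integral>\<^sup>+y. ennreal (hit_weight \<sigma> \<tau> y) \<partial>lborel)
     = ennreal (sqrt (2 * pi * exp 1 * \<tau>)) * (\<integral>\<^sup>+y. ennreal (normal_density 0 (sqrt (\<tau> + \<sigma>\<^sup>2)) y) \<partial>lborel)"
    using assms by (simp add: hit_weight_def ennreal_mult nn_integral_cmult)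
  also have "\<dots> = ennreal (sqrt (2 * pi * exp 1 * \<tau>))"
    using pos by (simp add: nn_integral_eq_integral)
  finally have *: "ennreal (sqrt (2 * pi * exp 1 * \<tau>)) = \<bar>a\<bar> * (\<integral>\<^sup>+y. ennreal (hit_weight \<sigma> \<tau> (c + a * y)) \<partial>lborel)"
    by (subst (asm) nn_integral_real_affine[where c=a and t=c]) (use assms in auto)
  have "ennreal (sqrt (2 * pi * exp 1 * \<tau>) / \<bar>a\<bar>) = ennreal (sqrt (2 * pi * exp 1 * \<tau>)) / ennreal \<bar>a\<bar>"
    using assms by (simp add: divide_ennreal)
  also have "\<dots> = (\<integral>\<^sup>+y. ennreal (hit_weight \<sigma> \<tau> (c + a * y)) \<partial>lborel)"
    unfolding * using assms by (subst mult.commute) (simp add: ennreal_mult_divide_eq)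
  finally show ?thesis by simp
qed

subsection \<open>Decoding by distance\<close>

lemma prob_space_noise: "0 < \<sigma> \<Longrightarrow> prob_space (noise n \<sigma>)"
  unfolding noise_def by (intro prob_space_PiM prob_space_normal_density)

lemma sets_noise: "sets (noise n \<sigma>) = sets (PiM {..<n} (\<lambda>_. lborel))"
  unfolding noise_def by (intro sets_PiM_cong) auto

lemma nn_integral_noise_prod:
  assumes "0 < \<sigma>" "\<And>k. k < n \<Longrightarrow> f k \<in> borel_measurable borel"
  shows "(\<integral>\<^sup>+z. (\<Prod>k<n. f k (z k)) \<partial>noise n \<sigma>)
    = (\<Prod>k<n. \<integral>\<^sup>+z. f k z \<partial>density lborel (normal_density 0 \<sigma>))"
proof -
  interpret N: prob_space "density lborel (normal_density 0 \<sigma>)"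
    by (rule prob_space_normal_density[OF assms(1)])
  interpret product_sigma_finite "\<lambda>_. density lborel (normal_density 0 \<sigma>)" ..
  show ?thesis
    unfolding noise_def using assms by (intro product_nn_integral_prod) auto
qed

lemma measurable_noise_component:
  "k < n \<Longrightarrow> (\<lambda>z. z k) \<in> borel_measurable (noise n \<sigma>)"
  by (simp add: measurable_cong_sets[OF sets_noise refl])

text \<open>An error requires either noise energy above \<open>n * \<tau>\<close> or a wrong own
  message that is near the output together with some message of the interferer. Each of these
  indicators is dominated by a Chernoff weight, and the weights are integrated over the noise. The
  interferer's message need not be recovered, so \<open>l'\<close> ranges over all messages,
  including \<open>l\<close>.\<close>

lemma ex_decoder:
  fixes \<sigma> \<rho> \<tau> a b :: real and x y :: "nat \<Rightarrow> nat \<Rightarrow> real"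
  assumes "0 < \<sigma>" "\<sigma> < \<rho>" "0 < \<tau>"
  shows "\<exists>g. valid_dec n g \<and> avg_err n \<sigma> a b x y M L g
    \<le> (\<rho> / \<sigma> * exp (- (1 / \<sigma>\<^sup>2 - 1 / \<rho>\<^sup>2) / 2 * \<tau>)) ^ n
     + (\<Sum>m\<in>{1..M}. \<Sum>l\<in>{1..L}. \<Sum>m'\<in>{1..M} - {m}. \<Sum>l'\<in>{1..L}.
          \<Prod>k<n. hit_weight \<sigma> \<tau> (a * x m k + b * y l k - a * x m' k - b * y l' k)) / (real M * real L)"
proof -
  define s where "s = (1 / \<sigma>\<^sup>2 - 1 / \<rho>\<^sup>2) / 2"
  define q where "q = \<rho> / \<sigma> * exp (- s * \<tau>)"
  define near where "near = (\<lambda>w m. m \<in> {1..M} \<and>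
     (\<exists>l\<in>{1..L}. (\<Sum>k<n. (w k - a * x m k - b * y l k)\<^sup>2) \<le> real n * \<tau>))"
  \<comment> \<open>If no message is near, the value is arbitrary; for a transmitted pair this
    happens only when the noise energy is too large, an event already counted as an error.\<close>
  define g where "g = (\<lambda>w. LEAST m. near w m)"
  define H where "H = (\<lambda>m l m' l'. \<Prod>k<n. hit_weight \<sigma> \<tau> (a * x m k + b * y l k - a * x m' k - b * y l' k))"
  define f where "f = (\<lambda>m l m' l' z. \<Prod>k<n. ennreal (exp ((\<tau> -
       (a * x m k + b * y l k - a * x m' k - b * y l' k + z k)\<^sup>2) / (2 * \<tau>))))"
  define f0 where "f0 = (\<lambda>z. \<Prod>k<n. ennreal (exp (s * ((z k)\<^sup>2 - \<tau>))))"
  have s: "0 < s"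
    using assms power_strict_mono[of \<sigma> \<rho> 2] by (simp add: s_def field_simps)
  have q: "0 \<le> q" using assms by (simp add: q_def)
  have Hnn: "0 \<le> H m l m' l'" for m l m' l'
    using assms by (auto simp: H_def intro!: prod_nonneg hit_weight_nonneg)
  interpret N: prob_space "noise n \<sigma>" by (rule prob_space_noise[OF assms(1)])
  have "valid_dec n g"
  proof -
    have [measurable]: "(\<lambda>w. w k) \<in> borel_measurable (PiM {..<n} (\<lambda>_. lborel))" if "k \<in> {..<n}" for k
      using measurable_component_singleton[OF that, of "\<lambda>_. lborel"] by simp
    show ?thesis
      unfolding valid_dec_def g_def near_def by measurable
  qed
  note measurable_noise_component[measurable]
  have [measurable]: "f m l m' l' \<in> borel_measurable (noise n \<sigma>)" for m l m' l'
    unfolding f_def by measurable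
  have [measurable]: "f0 \<in> borel_measurable (noise n \<sigma>)"
    unfolding f0_def by measurable
  have int_f: "(\<integral>\<^sup>+z. f m l m' l' z \<partial>noise n \<sigma>) = ennreal (H m l m' l')" for m l m' l'
    unfolding f_def H_def using assms
    by (subst nn_integral_noise_prod)
       (auto simp: nn_integral_gaussian_shifted_exp prod_ennreal hit_weight_nonneg)
  have int_f0: "(\<integral>\<^sup>+z. f0 z \<partial>noise n \<sigma>) = ennreal (q ^ n)"
  proof -
    have "(\<integral>\<^sup>+z. ennreal (exp (s * (z\<^sup>2 - \<tau>))) \<partial>density lborel (normal_density 0 \<sigma>)) = ennreal q"
      unfolding q_def s_def minus_divide_left
      by (rule nn_integral_gaussian_exp_square[OF assms(1,2)])
    then show ?thesis
      unfolding f0_def using assms q by (subst nn_integral_noise_prod) (auto simp: ennreal_power)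
  qed
  have err: "measure (noise n \<sigma>)
          {z \<in> space (noise n \<sigma>). g (restrict (\<lambda>k. a * x m k + b * y l k + z k) {..<n}) \<noteq> m}
        \<le> q ^ n + (\<Sum>m'\<in>{1..M} - {m}. \<Sum>l'\<in>{1..L}. H m l m' l')" (is "measure _ ?E \<le> _")
    if m: "m \<in> {1..M}" and l: "l \<in> {1..L}" for m l
  proof -
    define F where "F = (\<lambda>z. f0 z + (\<Sum>m'\<in>{1..M} - {m}. \<Sum>l'\<in>{1..L}. f m l m' l' z))"
    have F: "1 \<le> F z" if z: "z \<in> ?E" for z
    proof (cases "(\<Sum>k<n. (z k)\<^sup>2) \<le> real n * \<tau>")
      case False
      have "f0 z = ennreal (exp (s * ((\<Sum>k<n. (z k)\<^sup>2) - real n * \<tau>)))"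
        by (simp add: f0_def prod_ennreal exp_sum[symmetric] sum_distrib_left[symmetric] sum_subtractf)
      also have "\<dots> \<ge> 1"
        using False s by simp
      finally show ?thesis
        unfolding F_def by (meson le_iff_add order_trans)
    next
      case True
      let ?w = "restrict (\<lambda>k. a * x m k + b * y l k + z k) {..<n}"
      \<comment> \<open>With moderate noise the transmitted message is near, so \<open>g\<close>
        returns some near message. As that message differs from \<open>m\<close>, it supplies the
        false pair.\<close>
      have "near ?w m"
        unfolding near_def using True m l by (auto intro!: bexI[of _ l])
      then have "near ?w (g ?w)"
        unfolding g_def by (rule LeastI)
      moreover have "g ?w \<noteq> m" using z by simp
      ultimately obtain l' where l': "l' \<in> {1..L}" and m': "g ?w \<in> {1..M} - {m}"
        and le: "(\<Sum>k<n. (?w k - a * x (g ?w) k - b * y l' k)\<^sup>2) \<le> real n * \<tau>"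
        unfolding near_def by blast
      have "(\<Sum>k<n. (a * x m k + b * y l k - a * x (g ?w) k - b * y l' k + z k)\<^sup>2) \<le> real n * \<tau>"
        using le by (simp add: algebra_simps)
      then have "1 \<le> exp ((real n * \<tau> -
          (\<Sum>k<n. (a * x m k + b * y l k - a * x (g ?w) k - b * y l' k + z k)\<^sup>2)) / (2 * \<tau>))"
        using assms by simp
      then have "1 \<le> f m l (g ?w) l' z"
        by (simp add: f_def prod_ennreal exp_sum[symmetric] sum_divide_distrib[symmetric] sum_subtractf)
      also have "\<dots> \<le> (\<Sum>l'\<in>{1..L}. f m l (g ?w) l' z)"
        using l' by (intro member_le_sum) auto
      also have "\<dots> \<le> (\<Sum>m'\<in>{1..M} - {m}. \<Sum>l'\<in>{1..L}. f m l m' l' z)"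
        using m' by (intro member_le_sum[where f="\<lambda>m'. \<Sum>l'\<in>{1..L}. f m l m' l' z"]) auto
      finally show ?thesis
        unfolding F_def by (metis add_increasing zero_le)
    qed
    have [measurable]: "F \<in> borel_measurable (noise n \<sigma>)"
      unfolding F_def by measurable
    \<comment> \<open>Markov's inequality for \<open>F\<close> at level 1.\<close>
    have "emeasure (noise n \<sigma>) ?E \<le> emeasure (noise n \<sigma>) {z \<in> space (noise n \<sigma>). 1 \<le> F z}"
      using F by (intro emeasure_mono) auto
    also have "\<dots> = (\<integral>\<^sup>+z. indicator {z \<in> space (noise n \<sigma>). 1 \<le> F z} z \<partial>noise n \<sigma>)"
      by (rule nn_integral_indicator[symmetric]) measurable
    also have "\<dots> \<le> (\<integral>\<^sup>+z. F z \<partial>noise n \<sigma>)"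
      by (intro nn_integral_mono) (auto split: split_indicator)
    also have "\<dots> = ennreal (q ^ n + (\<Sum>m'\<in>{1..M} - {m}. \<Sum>l'\<in>{1..L}. H m l m' l'))"
      unfolding F_def using q Hnn
      by (simp add: nn_integral_add nn_integral_sum int_f int_f0 sum_nonneg)
    finally show ?thesis
      using q Hnn by (simp add: N.emeasure_eq_measure sum_nonneg del: ennreal_plus)
  qed
  have "avg_err n \<sigma> a b x y M L g \<le> (\<Sum>m\<in>{1..M}. \<Sum>l\<in>{1..L}.
       q ^ n + (\<Sum>m'\<in>{1..M} - {m}. \<Sum>l'\<in>{1..L}. H m l m' l')) / (real M * real L)"
    unfolding avg_err_def by (intro divide_right_mono sum_mono err) auto
  also have "\<dots> \<le> q ^ n + (\<Sum>m\<in>{1..M}. \<Sum>l\<in>{1..L}. \<Sum>m'\<in>{1..M} - {m}. \<Sum>l'\<in>{1..L}. H m l m' l') / (real M * real L)"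
    using q by (simp add: sum.distrib add_divide_distrib)
  finally show ?thesis
    using \<open>valid_dec n g\<close> unfolding q_def s_def H_def minus_divide_left by blast
qed

subsection \<open>Random codebooks\<close>

text \<open>Fubini with coordinate \<open>i\<close> as the inner variable: a bound uniform in the
  other coordinates survives averaging over a probability measure.\<close>

lemma nn_integral_PiM_le_slice:
  assumes "\<And>i. prob_space (M i)" "finite I" "i \<in> I"
    and f: "f \<in> borel_measurable (PiM I M)"
    and le: "\<And>x. x \<in> space (PiM (I - {i}) M) \<Longrightarrow> (\<integral>\<^sup>+y. f (x(i := y)) \<partial>M i) \<le> C"
  shows "(\<integral>\<^sup>+x. f x \<partial>PiM I M) \<le> C"
proof -
  interpret product_sigma_finite M
    by (rule product_sigma_finite.intro) (intro prob_space_imp_sigma_finite assms(1))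
  interpret J: prob_space "PiM (I - {i}) M" by (rule prob_space_PiM) (rule assms(1))
  have I: "insert i (I - {i}) = I" using assms by auto
  have "(\<integral>\<^sup>+x. f x \<partial>PiM I M) = (\<integral>\<^sup>+x. (\<integral>\<^sup>+y. f (x(i := y)) \<partial>M i) \<partial>PiM (I - {i}) M)"
    using product_nn_integral_insert[of "I - {i}" i f] assms(2) f unfolding I by simp
  also have "\<dots> \<le> (\<integral>\<^sup>+x. C \<partial>PiM (I - {i}) M)"
    by (intro nn_integral_mono le)
  also have "\<dots> = C" by (simp add: J.emeasure_space_1)
  finally show ?thesis .
qed

text \<open>Otherwise the integral would be at least \<open>2 * B\<close>, which exceeds
  \<open>B\<close>. The factor 2 gives the strict gap directly, with no measurability of
  \<open>f\<close> involved.\<close>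

lemma (in prob_space) ex_le_of_nn_integral_le:
  assumes "(\<integral>\<^sup>+x. f x \<partial>M) \<le> ennreal B" "0 < B"
  shows "\<exists>x\<in>space M. f x \<le> ennreal (2 * B)"
proof (rule ccontr)
  assume "\<not> ?thesis"
  then have "(\<integral>\<^sup>+x. ennreal (2 * B) \<partial>M) \<le> (\<integral>\<^sup>+x. f x \<partial>M)"
    by (intro nn_integral_mono) (auto simp: not_le)
  also have "\<dots> \<le> ennreal B" by fact
  finally show False
    using assms by (simp add: emeasure_space_1)
qed

text \<open>The codebooks of both users form one family indexed by pairs (user, message), so that any single
  codeword can be integrated out; \<open>v\<close> is the volume of \<open>K\<close> and \<open>M p\<close> the number of messages of user \<open>p\<close>.\<close>

locale random_codebook =
  fixes n :: nat and K :: "(nat \<Rightarrow> real) set" and v :: real and M :: "bool \<Rightarrow> nat" and \<sigma> \<tau> :: real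
  assumes K_sets: "K \<in> sets (PiM {..<n} (\<lambda>_. lborel))"
    and K_volume: "emeasure (PiM {..<n} (\<lambda>_. lborel)) K = ennreal v"
    and v_pos: "0 < v"
    and M_pos: "\<And>p. 0 < M p"
    and \<tau>_pos: "0 < \<tau>"
begin

abbreviation "L \<equiv> PiM {..<n} (\<lambda>_. lborel :: real measure)"

text \<open>Restricting the space first makes \<open>space U\<close> equal to \<open>K\<close>, so
  that every sampled codeword is admissible and not merely almost every one.\<close>

definition "U = uniform_measure (restrict_space L K) K"

definition "I = Sigma UNIV (\<lambda>p. {1..M p})"

abbreviation "\<Omega> \<equiv> PiM I (\<lambda>_. U)"

lemma finite_I: "finite I"
  by (simp add: I_def finite_SigmaI)

lemma K_restrict_sets: "K \<in> sets (restrict_space L K)"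
  using K_sets by (simp add: sets_restrict_space_iff)

lemma emeasure_restrict: "emeasure (restrict_space L K) K = ennreal v"
  using K_sets K_volume by (simp add: emeasure_restrict_space)

lemma prob_space_U: "prob_space U"
  unfolding U_def using v_pos by (intro prob_space_uniform_measure) (auto simp: emeasure_restrict)

lemma space_U: "space U = K"
  using K_sets by (simp add: U_def)

lemma sets_U: "sets U = sets (restrict_space L K)"
  by (simp add: U_def)

lemma prob_space_\<Omega>: "prob_space \<Omega>"
  by (intro prob_space_PiM prob_space_U)

lemma measurable_letter: "k < n \<Longrightarrow> (\<lambda>y. y k) \<in> borel_measurable U"
  using measurable_component_singleton[of k "{..<n}" "\<lambda>_. lborel :: real measure"]
  by (subst measurable_cong_sets[OF sets_U refl]) (auto intro!: measurable_restrict_space1)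

lemma measurable_code_letter: "i \<in> I \<Longrightarrow> k < n \<Longrightarrow> (\<lambda>x. x i k) \<in> borel_measurable \<Omega>"
  using measurable_compose[OF measurable_component_singleton[of i I "\<lambda>_. U"] measurable_letter[of k]] by simp

text \<open>The density is \<open>1 / v\<close> on \<open>K\<close>; for a nonnegative integrand,
  extending the integral to the whole space only increases it.\<close>

lemma nn_integral_U_le:
  assumes [measurable]: "f \<in> borel_measurable L"
  shows "(\<integral>\<^sup>+y. f y \<partial>U) \<le> (\<integral>\<^sup>+y. f y \<partial>L) / ennreal v"
proof -
  have "(\<integral>\<^sup>+y. f y \<partial>U) = (\<integral>\<^sup>+y. f y * indicator K y \<partial>restrict_space L K) / ennreal v"
    unfolding U_def using K_restrict_sets
    by (subst nn_integral_uniform_measure) (auto intro: measurable_restrict_space1 simp: emeasure_restrict)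
  also have "\<dots> = (\<integral>\<^sup>+y. f y * indicator K y * indicator K y \<partial>L) / ennreal v"
    using K_sets by (subst nn_integral_restrict_space) auto
  also have "\<dots> \<le> (\<integral>\<^sup>+y. f y \<partial>L) / ennreal v"
    by (intro divide_right_mono_ennreal nn_integral_mono) (auto split: split_indicator)
  finally show ?thesis .
qed

text \<open>To exponential order, \<open>W ^ n\<close> is the volume of an
  \<open>n\<close>-dimensional ball of squared radius \<open>n * \<tau>\<close>.\<close>

definition "W = sqrt (2 * pi * exp 1 * \<tau>)"

lemma W_pos: "0 < W" using \<tau>_pos by (simp add: W_def)

lemma nn_integral_slice_le:
  assumes "a \<noteq> 0"
  shows "(\<integral>\<^sup>+y. ennreal (\<Prod>k<n. hit_weight \<sigma> \<tau> (c k + a * y k)) \<partial>U) \<le> ennreal ((W / \<bar>a\<bar>) ^ n / v)"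
proof -
  interpret product_sigma_finite "\<lambda>_. lborel :: real measure" ..
  have eq: "ennreal (\<Prod>k<n. hit_weight \<sigma> \<tau> (c k + a * y k)) = (\<Prod>k<n. ennreal (hit_weight \<sigma> \<tau> (c k + a * y k)))" for y
    using \<tau>_pos by (simp add: prod_ennreal hit_weight_nonneg)
  have "(\<integral>\<^sup>+y. ennreal (\<Prod>k<n. hit_weight \<sigma> \<tau> (c k + a * y k)) \<partial>U)
      \<le> (\<integral>\<^sup>+y. ennreal (\<Prod>k<n. hit_weight \<sigma> \<tau> (c k + a * y k)) \<partial>L) / ennreal v"
    by (intro nn_integral_U_le) measurable
  also have "(\<integral>\<^sup>+y. ennreal (\<Prod>k<n. hit_weight \<sigma> \<tau> (c k + a * y k)) \<partial>L) = ennreal ((W / \<bar>a\<bar>) ^ n)"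
    unfolding eq using assms \<tau>_pos
    by (subst product_nn_integral_prod) (auto simp: nn_integral_hit_weight W_def ennreal_power)
  also have "ennreal ((W / \<bar>a\<bar>) ^ n) / ennreal v = ennreal ((W / \<bar>a\<bar>) ^ n / v)"
    using v_pos W_pos by (simp add: divide_ennreal)
  finally show ?thesis .
qed

text \<open>Only codeword \<open>i\<close> is integrated out. The assumption \<open>upd\<close> says
  that the shift does not involve it, so the slice bound applies for every choice of the remaining
  codewords.\<close>

lemma nn_integral_code_le:
  assumes i: "i \<in> I" and a: "a \<noteq> 0"
    and c: "\<And>k. k < n \<Longrightarrow> (\<lambda>x. c x k) \<in> borel_measurable \<Omega>"
    and upd: "\<And>x y k. c (x(i := y)) k = c x k"
  shows "(\<integral>\<^sup>+x. ennreal (\<Prod>k<n. hit_weight \<sigma> \<tau> (c x k + a * x i k)) \<partial>\<Omega>) \<le> ennreal ((W / \<bar>a\<bar>) ^ n / v)"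
proof (rule nn_integral_PiM_le_slice[OF prob_space_U finite_I i])
  note [measurable] = c measurable_code_letter[OF i]
  show "(\<lambda>x. ennreal (\<Prod>k<n. hit_weight \<sigma> \<tau> (c x k + a * x i k))) \<in> borel_measurable \<Omega>"
    by measurable
  show "(\<integral>\<^sup>+y. ennreal (\<Prod>k<n. hit_weight \<sigma> \<tau> (c (x(i := y)) k + a * (x(i := y)) i k)) \<partial>U)
      \<le> ennreal ((W / \<bar>a\<bar>) ^ n / v)" for x
    using nn_integral_slice_le[OF a] by (simp add: upd)
qed

text \<open>The noise-averaged weight with which receiver \<open>p\<close> accepts the pair
  (\<open>m'\<close>, \<open>l'\<close>) when (\<open>m\<close>, \<open>l\<close>) was sent;
  \<open>a\<close> is the direct gain and \<open>b\<close> the gain of the interferer.\<close>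

definition confusion :: "bool \<Rightarrow> real \<Rightarrow> real \<Rightarrow> (bool \<times> nat \<Rightarrow> nat \<Rightarrow> real) \<Rightarrow> nat \<Rightarrow> nat \<Rightarrow> nat \<Rightarrow> nat \<Rightarrow> real" where
  "confusion p a b x m l m' l' = (\<Prod>k<n. hit_weight \<sigma> \<tau>
     (a * x (p, m) k + b * x (\<not> p, l) k - a * x (p, m') k - b * x (\<not> p, l') k))"

lemma confusion_nonneg: "0 \<le> confusion p a b x m l m' l'"
  using \<tau>_pos by (auto simp: confusion_def intro!: prod_nonneg hit_weight_nonneg)

lemma measurable_confusion:
  assumes "m \<in> {1..M p}" "l \<in> {1..M (\<not> p)}" "m' \<in> {1..M p}" "l' \<in> {1..M (\<not> p)}"
  shows "(\<lambda>x. confusion p a b x m l m' l') \<in> borel_measurable \<Omega>"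
proof -
  have "(p, m) \<in> I" "(p, m') \<in> I" "(\<not> p, l) \<in> I" "(\<not> p, l') \<in> I"
    using assms by (auto simp: I_def)
  note [measurable] = this[THEN measurable_code_letter]
  show ?thesis unfolding confusion_def by measurable
qed

text \<open>Since \<open>m'\<close> differs from \<open>m\<close>, the false own codeword occurs
  only once, with coefficient \<open>- a\<close>, and can be integrated out.\<close>

lemma nn_integral_confusion_own:
  assumes "m \<in> {1..M p}" "l \<in> {1..M (\<not> p)}" "m' \<in> {1..M p} - {m}" "l' \<in> {1..M (\<not> p)}" "0 < a"
  shows "(\<integral>\<^sup>+x. ennreal (confusion p a b x m l m' l') \<partial>\<Omega>) \<le> ennreal ((W / a) ^ n / v)"
proof -
  have I: "(p, m) \<in> I" "(p, m') \<in> I" "(\<not> p, l) \<in> I" "(\<not> p, l') \<in> I"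
    using assms by (auto simp: I_def)
  note [measurable] = I[THEN measurable_code_letter]
  show ?thesis
    using nn_integral_code_le[OF I(2), of "- a"
      "\<lambda>x k. a * x (p, m) k + b * x (\<not> p, l) k - b * x (\<not> p, l') k"] assms
    by (auto simp: confusion_def algebra_simps)
qed

text \<open>The same with the false codeword of the interferer, whose coefficient is
  \<open>- b\<close>. Here \<open>m'\<close> may equal \<open>m\<close>.\<close>

lemma nn_integral_confusion_other:
  assumes "m \<in> {1..M p}" "l \<in> {1..M (\<not> p)}" "m' \<in> {1..M p}" "l' \<in> {1..M (\<not> p)} - {l}" "0 < b"
  shows "(\<integral>\<^sup>+x. ennreal (confusion p a b x m l m' l') \<partial>\<Omega>) \<le> ennreal ((W / b) ^ n / v)"
proof -
  have I: "(p, m) \<in> I" "(p, m') \<in> I" "(\<not> p, l) \<in> I" "(\<not> p, l') \<in> I"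
    using assms by (auto simp: I_def)
  note [measurable] = I[THEN measurable_code_letter]
  show ?thesis
    using nn_integral_code_le[OF I(4), of "- b"
      "\<lambda>x k. a * x (p, m) k + b * x (\<not> p, l) k - a * x (p, m') k"] assms
    by (auto simp: confusion_def algebra_simps)
qed

definition mean_confusion :: "bool \<Rightarrow> real \<Rightarrow> real \<Rightarrow> (bool \<times> nat \<Rightarrow> nat \<Rightarrow> real) \<Rightarrow> real" where
  "mean_confusion p a b x = (\<Sum>m\<in>{1..M p}. \<Sum>l\<in>{1..M (\<not> p)}. \<Sum>m'\<in>{1..M p} - {m}. \<Sum>l'\<in>{1..M (\<not> p)}.
      confusion p a b x m l m' l') / (real (M p) * real (M (\<not> p)))"

text \<open>The first summand belongs to \<open>l' = l\<close>, where only the own codeword is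
  wrong. If both are wrong, either can be integrated out, and the larger gain gives the smaller
  bound. In both places the subtraction of 1 counts the wrong messages only.\<close>

definition confusion_bound :: "bool \<Rightarrow> real \<Rightarrow> real \<Rightarrow> real" where
  "confusion_bound p a b = (real (M p) - 1) * ((W / a) ^ n / v
     + (real (M (\<not> p)) - 1) * ((W / max a b) ^ n / v))"

lemma mean_confusion_nonneg: "0 \<le> mean_confusion p a b x"
  unfolding mean_confusion_def by (intro divide_nonneg_nonneg sum_nonneg confusion_nonneg) auto

lemma measurable_mean_confusion: "(\<lambda>x. mean_confusion p a b x) \<in> borel_measurable \<Omega>"
  unfolding mean_confusion_def
  by (intro borel_measurable_divide borel_measurable_sum measurable_confusion borel_measurable_const) auto

lemma confusion_bound_nonneg: "0 < a \<Longrightarrow> 0 < b \<Longrightarrow> 0 \<le> confusion_bound p a b"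
  using M_pos[of p] M_pos[of "\<not> p"] W_pos v_pos by (auto simp: confusion_bound_def)

lemma nn_integral_mean_confusion:
  assumes "0 < a" "0 < b"
  shows "(\<integral>\<^sup>+x. ennreal (mean_confusion p a b x) \<partial>\<Omega>) \<le> ennreal (confusion_bound p a b)"
proof -
  let ?A = "(W / a) ^ n / v" and ?B = "(W / max a b) ^ n / v"
  have A: "0 \<le> ?A" and B: "0 \<le> ?B" using assms W_pos v_pos by auto
  have Mp: "1 \<le> real (M p)" "1 \<le> real (M (\<not> p))" using M_pos[of p] M_pos[of "\<not> p"] by auto
  have inner: "(\<Sum>l'\<in>{1..M (\<not> p)}. \<integral>\<^sup>+x. ennreal (confusion p a b x m l m' l') \<partial>\<Omega>)
      \<le> ennreal (?A + (real (M (\<not> p)) - 1) * ?B)"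
    if H: "m \<in> {1..M p}" "l \<in> {1..M (\<not> p)}" "m' \<in> {1..M p} - {m}" for m l m'
  proof -
    \<comment> \<open>The correct message of the interferer is split off, as only the own codeword
      can be integrated out there.\<close>
    have "(\<Sum>l'\<in>{1..M (\<not> p)}. \<integral>\<^sup>+x. ennreal (confusion p a b x m l m' l') \<partial>\<Omega>)
       = (\<integral>\<^sup>+x. ennreal (confusion p a b x m l m' l) \<partial>\<Omega>)
         + (\<Sum>l'\<in>{1..M (\<not> p)} - {l}. \<integral>\<^sup>+x. ennreal (confusion p a b x m l m' l') \<partial>\<Omega>)"
      using H by (intro sum.remove) auto
    also have "\<dots> \<le> ennreal ?A + (\<Sum>l'\<in>{1..M (\<not> p)} - {l}. ennreal ?B)"
    proof (intro add_mono sum_mono)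
      show "(\<integral>\<^sup>+x. ennreal (confusion p a b x m l m' l) \<partial>\<Omega>) \<le> ennreal ?A"
        using H assms by (intro nn_integral_confusion_own)
      fix l' assume l': "l' \<in> {1..M (\<not> p)} - {l}"
      \<comment> \<open>Both codewords are wrong; the one with the larger of the two gains is
        integrated out.\<close>
      show "(\<integral>\<^sup>+x. ennreal (confusion p a b x m l m' l') \<partial>\<Omega>) \<le> ennreal ?B"
        using nn_integral_confusion_own[OF H, of l' a b] nn_integral_confusion_other[of m p l m' l' b a]
          H l' assms by (auto simp: max_def)
    qed
    also have "(\<Sum>l'\<in>{1..M (\<not> p)} - {l}. ennreal ?B) = ennreal ((real (M (\<not> p)) - 1) * ?B)"
      using H B Mp by (subst ennreal_mult) (auto simp: ennreal_of_nat_eq_real_of_nat of_nat_diff)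
    also have "ennreal ?A + ennreal ((real (M (\<not> p)) - 1) * ?B) = ennreal (?A + (real (M (\<not> p)) - 1) * ?B)"
      using A B Mp by (intro ennreal_plus[symmetric] mult_nonneg_nonneg) auto
    finally show ?thesis .
  qed
  have "(\<integral>\<^sup>+x. ennreal (mean_confusion p a b x) \<partial>\<Omega>)
     = (\<integral>\<^sup>+x. (\<Sum>m\<in>{1..M p}. \<Sum>l\<in>{1..M (\<not> p)}. \<Sum>m'\<in>{1..M p} - {m}. \<Sum>l'\<in>{1..M (\<not> p)}.
      ennreal (confusion p a b x m l m' l')) / ennreal (real (M p) * real (M (\<not> p))) \<partial>\<Omega>)"
    unfolding mean_confusion_def using Mp
    by (intro nn_integral_cong)
       (subst divide_ennreal[symmetric], auto simp: sum_ennreal confusion_nonneg sum_nonneg)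
  also have "\<dots> = (\<Sum>m\<in>{1..M p}. \<Sum>l\<in>{1..M (\<not> p)}. \<Sum>m'\<in>{1..M p} - {m}. \<Sum>l'\<in>{1..M (\<not> p)}.
      \<integral>\<^sup>+x. ennreal (confusion p a b x m l m' l') \<partial>\<Omega>) / ennreal (real (M p) * real (M (\<not> p)))"
    by (subst nn_integral_divide nn_integral_sum,
        (intro borel_measurable_sum measurable_compose[OF measurable_confusion] measurable_ennreal; auto),
        (intro arg_cong[where f="\<lambda>t. t / ennreal (real (M p) * real (M (\<not> p)))"] sum.cong refl)?)+
  also have "\<dots> \<le> (\<Sum>m\<in>{1..M p}. \<Sum>l\<in>{1..M (\<not> p)}. \<Sum>m'\<in>{1..M p} - {m}.
      ennreal (?A + (real (M (\<not> p)) - 1) * ?B)) / ennreal (real (M p) * real (M (\<not> p)))"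
    by (intro divide_right_mono_ennreal sum_mono inner)
  also have "(\<Sum>m\<in>{1..M p}. \<Sum>l\<in>{1..M (\<not> p)}. \<Sum>m'\<in>{1..M p} - {m}.
      ennreal (?A + (real (M (\<not> p)) - 1) * ?B))
      = ennreal (real (M p) * real (M (\<not> p)) * confusion_bound p a b)"
  proof -
    have "0 \<le> ?A + (real (M (\<not> p)) - 1) * ?B" using A B Mp by (intro add_nonneg_nonneg mult_nonneg_nonneg) auto
    then show ?thesis
      unfolding confusion_bound_def using Mp
      by (simp add: ennreal_mult ennreal_of_nat_eq_real_of_nat of_nat_diff mult_ac del: ennreal_plus)
  qed
  also have "ennreal (real (M p) * real (M (\<not> p)) * confusion_bound p a b)
      / ennreal (real (M p) * real (M (\<not> p))) = ennreal (confusion_bound p a b)"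
    using confusion_bound_nonneg[OF assms, of p] Mp by (subst divide_ennreal) auto
  finally show ?thesis .
qed

text \<open>The same codebooks must serve both receivers. The first-moment argument is therefore
  applied to the sum of the two mean confusions, each of which is nonnegative and hence bounded by
  the sum.\<close>

lemma ex_codebook:
  assumes "0 < a" "0 < b" "0 < c" "0 < d" "confusion_bound True a b + confusion_bound False c d < B"
  shows "\<exists>x. (\<forall>p. \<forall>m\<in>{1..M p}. x p m \<in> K)
    \<and> mean_confusion True a b (case_prod x) \<le> 2 * B \<and> mean_confusion False c d (case_prod x) \<le> 2 * B"
proof -
  note nn = confusion_bound_nonneg
  interpret \<Omega>: prob_space \<Omega> by (rule prob_space_\<Omega>)
  have "(\<integral>\<^sup>+x. ennreal (mean_confusion True a b x) + ennreal (mean_confusion False c d x) \<partial>\<Omega>)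
      \<le> ennreal (confusion_bound True a b) + ennreal (confusion_bound False c d)"
    using assms measurable_mean_confusion
    by (subst nn_integral_add) (auto intro!: add_mono nn_integral_mean_confusion)
  also have "\<dots> \<le> ennreal B"
    using assms by (subst ennreal_plus[symmetric]) (auto intro!: nn ennreal_leI)
  finally obtain x where x: "x \<in> space \<Omega>"
    and le: "ennreal (mean_confusion True a b x) + ennreal (mean_confusion False c d x) \<le> ennreal (2 * B)"
    using \<Omega>.ex_le_of_nn_integral_le assms nn[of a b True] nn[of c d False] by (meson add_nonneg_nonneg order_le_less_trans)
  have B: "0 \<le> 2 * B" using assms nn[of a b True] nn[of c d False] by linarith
  have "mean_confusion True a b x + mean_confusion False c d x \<le> 2 * B"
    using le B mean_confusion_nonneg[of True a b x] mean_confusion_nonneg[of False c d x]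
    by (simp add: ennreal_plus[symmetric] del: ennreal_plus)
  moreover have "x (p, m) \<in> K" if "m \<in> {1..M p}" for p m
    using x that by (auto simp: space_PiM I_def space_U)
  ultimately show ?thesis
    using mean_confusion_nonneg[of True a b x] mean_confusion_nonneg[of False c d x]
    by (intro exI[of _ "curry x"]) auto
qed

end

subsection \<open>Volume of the set of admissible words\<close>

text \<open>This is the set taken for \<open>K\<close> in the random codebooks.\<close>

definition cost_ball :: "nat \<Rightarrow> real \<Rightarrow> real \<Rightarrow> (nat \<Rightarrow> real) set" where
  "cost_ball n \<alpha> A = {x \<in> space (PiM {..<n} (\<lambda>_. lborel :: real measure)).
     (\<forall>k\<in>{..<n}. 0 \<le> x k \<and> x k \<le> A) \<and> (\<Sum>k<n. x k) \<le> real n * \<alpha> * A}"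

lemma cost_ball_sets: "cost_ball n \<alpha> A \<in> sets (PiM {..<n} (\<lambda>_. lborel))"
proof -
  have [measurable]: "(\<lambda>w. w k) \<in> borel_measurable (PiM {..<n} (\<lambda>_. lborel :: real measure))" if "k \<in> {..<n}" for k
    using measurable_component_singleton[OF that, of "\<lambda>_. lborel"] by simp
  show ?thesis unfolding cost_ball_def by measurable
qed

section \<open>The truncated exponential family on the unit interval\<close>

definition expo_mass :: "real \<Rightarrow> real" where
  "expo_mass \<nu> = (1 - exp (- \<nu>)) / \<nu>"

text \<open>The mean of the density proportional to \<open>exp (- \<nu> * x)\<close> on the unit
  interval; the normalising integral of that density is \<open>expo_mass \<nu>\<close>.\<close>

definition expo_mean :: "real \<Rightarrow> real" where
  "expo_mean \<nu> = 1 / \<nu> - 1 / (exp \<nu> - 1)"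

lemma expo_mass_pos: "0 < \<nu> \<Longrightarrow> 0 < expo_mass \<nu>"
  by (simp add: expo_mass_def)

text \<open>The derivative of a log-partition function is minus the mean of the tilted
  density.\<close>

lemma DERIV_ln_expo_mass:
  assumes "0 < \<nu>"
  shows "((\<lambda>\<nu>. ln (expo_mass \<nu>)) has_real_derivative - expo_mean \<nu>) (at \<nu>)"
proof -
  have e: "1 < exp \<nu>" using assms by simp
  have "((\<lambda>\<nu>. ln (expo_mass \<nu>)) has_real_derivative
      inverse ((1 - exp (- \<nu>)) / \<nu>) * ((exp (- \<nu>) * \<nu> - (1 - exp (- \<nu>))) / \<nu>\<^sup>2)) (at \<nu>)"
    unfolding expo_mass_def using assms
    by (auto intro!: derivative_eq_intros simp: field_simps power2_eq_square)
  also have "inverse ((1 - exp (- \<nu>)) / \<nu>) * ((exp (- \<nu>) * \<nu> - (1 - exp (- \<nu>))) / \<nu>\<^sup>2) = - expo_mean \<nu>"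
    using assms e by (simp add: expo_mean_def exp_minus field_simps power2_eq_square)
  finally show ?thesis .
qed

lemma nn_integral_expo:
  assumes "0 < A" "0 < \<nu>"
  shows "(\<integral>\<^sup>+x. ennreal (exp (- \<nu> * x / A) * indicator {0..A} x) \<partial>lborel) = ennreal (A * expo_mass \<nu>)"
proof -
  have "(\<integral>\<^sup>+x. ennreal (exp (- \<nu> * x / A)) * indicator {0..A} x \<partial>lborel)
     = ennreal (- (A / \<nu>) * exp (- \<nu> * A / A) - (- (A / \<nu>) * exp (- \<nu> * 0 / A)))"
    using assms
    by (intro nn_integral_FTC_Icc[where F="\<lambda>x. - (A / \<nu>) * exp (- \<nu> * x / A)"])
       (auto intro!: derivative_eq_intros simp: has_real_derivative_iff_has_vector_derivative[symmetric] field_simps)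
  also have "- (A / \<nu>) * exp (- \<nu> * A / A) - (- (A / \<nu>) * exp (- \<nu> * 0 / A)) = A * expo_mass \<nu>"
    using assms by (simp add: expo_mass_def field_simps)
  also have "(\<integral>\<^sup>+x. ennreal (exp (- \<nu> * x / A)) * indicator {0..A} x \<partial>lborel)
     = (\<integral>\<^sup>+x. ennreal (exp (- \<nu> * x / A) * indicator {0..A} x) \<partial>lborel)"
    by (intro nn_integral_cong) (auto split: split_indicator)
  finally show ?thesis .
qed

text \<open>Chernoff bounds: under the density proportional to \<open>exp (- \<mu> x / A)\<close> on \<open>[0, A]\<close>, the empirical mean
  concentrates near \<open>expo_mean \<mu> * A\<close>, and on that event the density is nearly constant.\<close>

lemma emeasure_cost_ball_ge:
  assumes "0 < A" "0 < s" "s < \<mu>" "\<beta> \<le> \<alpha>"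
  shows "ennreal ((A * expo_mass \<mu>) ^ n)
    \<le> ennreal (exp (- \<mu> * \<gamma>) ^ n) * emeasure (PiM {..<n} (\<lambda>_. lborel)) (cost_ball n \<alpha> A)
      + ennreal ((A * (exp (- s * \<beta>) * expo_mass (\<mu> - s))) ^ n)
      + ennreal ((A * (exp (s * \<gamma>) * expo_mass (\<mu> + s))) ^ n)"
proof -
  let ?L = "PiM {..<n} (\<lambda>_. lborel :: real measure)"
  interpret product_sigma_finite "\<lambda>_. lborel :: real measure" ..
  define P where "P = (\<lambda>\<nu> (x :: nat \<Rightarrow> real). \<Prod>k<n. ennreal (exp (- \<nu> * x k / A) * indicator {0..A} (x k)))"
  have [measurable]: "(\<lambda>w. w k) \<in> borel_measurable ?L" if "k \<in> {..<n}" for k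
    using measurable_component_singleton[OF that, of "\<lambda>_. lborel"] by simp
  have [measurable]: "P \<nu> \<in> borel_measurable ?L" for \<nu>
    unfolding P_def by measurable
  have int_P: "(\<integral>\<^sup>+x. P \<nu> x \<partial>?L) = ennreal ((A * expo_mass \<nu>) ^ n)" if "0 < \<nu>" for \<nu>
    unfolding P_def using assms that expo_mass_pos[OF that]
    by (subst product_nn_integral_prod) (auto simp: nn_integral_expo[simplified] ennreal_power)
  \<comment> \<open>Three cases for the normalised sum \<open>S\<close>. Above
    \<open>n * \<beta>\<close> the tilt is lowered by \<open>s\<close>, below
    \<open>n * \<gamma>\<close> it is raised by \<open>s\<close>; in between the word is admissible
    and its weight is at most \<open>exp (- \<mu> * \<gamma>) ^ n\<close>.\<close>
  have le: "P \<mu> x \<le> ennreal (exp (- \<mu> * \<gamma>) ^ n) * indicator (cost_ball n \<alpha> A) x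
      + ennreal (exp (- s * \<beta>) ^ n) * P (\<mu> - s) x + ennreal (exp (s * \<gamma>) ^ n) * P (\<mu> + s) x"
    (is "_ \<le> ?a + ?b + ?c") if x: "x \<in> space ?L" for x
  proof (cases "\<forall>k\<in>{..<n}. 0 \<le> x k \<and> x k \<le> A")
    case False
    then obtain k where "k \<in> {..<n}" "x k \<notin> {0..A}" by auto
    then have "P \<mu> x = 0" unfolding P_def by (intro prod_zero bexI[of _ k]) auto
    then show ?thesis by simp
  next
    case True
    define S where "S = (\<Sum>k<n. x k) / A"
    have P: "P \<nu> x = ennreal (exp (- \<nu> * S))" for \<nu>
    proof -
      have "P \<nu> x = (\<Prod>k<n. ennreal (exp (- \<nu> * x k / A)))"
        unfolding P_def using True by (intro prod.cong) auto
      then show ?thesis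
        by (simp add: prod_ennreal exp_sum[symmetric] S_def sum_negf
              sum_divide_distrib[symmetric] sum_distrib_left[symmetric])
    qed
    consider "real n * \<beta> < S" | "S < real n * \<gamma>" | "S \<le> real n * \<beta>" "real n * \<gamma> \<le> S" by linarith
    then show ?thesis
    proof cases
      case 1
      then have "s * (real n * \<beta>) \<le> s * S" using assms by (intro mult_left_mono) auto
      then have "- \<mu> * S \<le> real n * (- s * \<beta>) + - (\<mu> - s) * S" by (simp add: algebra_simps)
      then have "P \<mu> x \<le> ?b"
        unfolding P by (simp add: ennreal_mult[symmetric] exp_of_nat_mult[symmetric] exp_add[symmetric])
      then show ?thesis by (metis add.commute add_increasing2 order_trans zero_le le_iff_add)
    next
      case 2
      then have "s * S \<le> s * (real n * \<gamma>)" using assms by (intro mult_left_mono) auto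
      then have "- \<mu> * S \<le> real n * (s * \<gamma>) + - (\<mu> + s) * S" by (simp add: algebra_simps)
      then have "P \<mu> x \<le> ?c"
        unfolding P by (simp add: ennreal_mult[symmetric] exp_of_nat_mult[symmetric] exp_add[symmetric])
      then show ?thesis by (metis add_increasing zero_le)
    next
      case 3
      have "(\<Sum>k<n. x k) = S * A" using assms by (simp add: S_def)
      also have "\<dots> \<le> real n * \<beta> * A" using 3 assms by (intro mult_right_mono) auto
      also have "\<dots> \<le> real n * \<alpha> * A" using assms by (intro mult_right_mono mult_left_mono) auto
      finally have "x \<in> cost_ball n \<alpha> A" using x True by (auto simp: cost_ball_def)
      moreover have "- \<mu> * S \<le> real n * (- \<mu> * \<gamma>)"
        using mult_left_mono[OF 3(2), of \<mu>] assms by (simp add: algebra_simps)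
      ultimately have "P \<mu> x \<le> ?a"
        unfolding P by (simp add: exp_of_nat_mult[symmetric])
      then show ?thesis by (metis le_iff_add order_trans)
    qed
  qed
  have "ennreal ((A * expo_mass \<mu>) ^ n) = (\<integral>\<^sup>+x. P \<mu> x \<partial>?L)"
    using assms by (subst int_P) auto
  also have "\<dots> \<le> (\<integral>\<^sup>+x. ennreal (exp (- \<mu> * \<gamma>) ^ n) * indicator (cost_ball n \<alpha> A) x
      + ennreal (exp (- s * \<beta>) ^ n) * P (\<mu> - s) x + ennreal (exp (s * \<gamma>) ^ n) * P (\<mu> + s) x \<partial>?L)"
    by (intro nn_integral_mono le)
  also have "\<dots> = ennreal (exp (- \<mu> * \<gamma>) ^ n) * emeasure ?L (cost_ball n \<alpha> A)
      + ennreal (exp (- s * \<beta>) ^ n) * ennreal ((A * expo_mass (\<mu> - s)) ^ n)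
      + ennreal (exp (s * \<gamma>) ^ n) * ennreal ((A * expo_mass (\<mu> + s)) ^ n)"
    using cost_ball_sets[of n \<alpha> A] assms
    by (simp add: nn_integral_add nn_integral_cmult nn_integral_cmult_indicator int_P)
  also have "ennreal (exp (- s * \<beta>) ^ n) * ennreal ((A * expo_mass (\<mu> - s)) ^ n)
      = ennreal ((A * (exp (- s * \<beta>) * expo_mass (\<mu> - s))) ^ n)"
    using expo_mass_pos[of "\<mu> - s"] assms by (subst ennreal_mult[symmetric]) (auto simp: power_mult_distrib mult_ac)
  also have "ennreal (exp (s * \<gamma>) ^ n) * ennreal ((A * expo_mass (\<mu> + s)) ^ n)
      = ennreal ((A * (exp (s * \<gamma>) * expo_mass (\<mu> + s))) ^ n)"
    using expo_mass_pos[of "\<mu> + s"] assms by (subst ennreal_mult[symmetric]) (auto simp: power_mult_distrib mult_ac)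
  finally show ?thesis .
qed

lemma emeasure_cost_ball_finite: "emeasure (PiM {..<n} (\<lambda>_. lborel)) (cost_ball n \<alpha> A) < \<infinity>"
proof -
  let ?L = "PiM {..<n} (\<lambda>_. lborel :: real measure)"
  interpret product_sigma_finite "\<lambda>_. lborel :: real measure" ..
  have "emeasure ?L (cost_ball n \<alpha> A) \<le> emeasure ?L (PiE {..<n} (\<lambda>_. {0..A}))"
    by (intro emeasure_mono sets_PiM_I_finite) (auto simp: cost_ball_def space_PiM)
  also have "\<dots> = (\<Prod>k<n. emeasure lborel {0..A})"
    by (intro emeasure_PiM) auto
  also have "\<dots> < \<infinity>"
    by (cases "0 \<le> A") (auto simp: ennreal_power power_0_left)
  finally show ?thesis .
qed

text \<open>The two tails are negligible against the total mass, so at least half of the mass lies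
  on admissible words. As \<delta> tends to 0, the logarithm of the base, apart from
  \<open>ln A\<close>, tends to \<open>ln (expo_mass \<mu>) + \<mu> * expo_mean \<mu>\<close>, the
  differential entropy of the truncated exponential law on the unit interval.\<close>

lemma eventually_cost_ball_volume:
  assumes "0 < A" "0 < \<mu>" "0 < \<delta>" "expo_mean \<mu> + \<delta> \<le> \<alpha>"
  shows "\<forall>\<^sub>F n in sequentially. (A * (expo_mass \<mu> * exp (\<mu> * (expo_mean \<mu> - \<delta>)))) ^ n / 2
    \<le> measure (PiM {..<n} (\<lambda>_. lborel)) (cost_ball n \<alpha> A)"
proof -
  define \<beta> where "\<beta> = expo_mean \<mu> + \<delta>"
  define \<gamma> where "\<gamma> = expo_mean \<mu> - \<delta>"
  have D: "((\<lambda>t. ln (expo_mass t) + t * c) has_real_derivative - expo_mean \<mu> + c) (at \<mu>)" for c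
    using DERIV_add[OF DERIV_ln_expo_mass[OF assms(2)] DERIV_cmult_right[OF DERIV_ident, where c = c]] by simp
  \<comment> \<open>The derivative at \<mu> is \<open>\<beta> - expo_mean \<mu> = \<delta>\<close>,
    which is positive, so a slightly smaller tilt improves the upper tail bound. For \<gamma> the
    derivative is \<open>- \<delta>\<close>, and a slightly larger tilt improves the lower
    one.\<close>
  have "\<exists>d>0. \<forall>h>0. h < d \<longrightarrow> ln (expo_mass (\<mu> - h)) + (\<mu> - h) * \<beta> < ln (expo_mass \<mu>) + \<mu> * \<beta>"
    using DERIV_pos_inc_left[OF D[of \<beta>]] assms by (simp add: \<beta>_def)
  then obtain d1 where d1: "0 < d1"
    "\<And>h. 0 < h \<Longrightarrow> h < d1 \<Longrightarrow> ln (expo_mass (\<mu> - h)) + (\<mu> - h) * \<beta> < ln (expo_mass \<mu>) + \<mu> * \<beta>" by blast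
  have "\<exists>d>0. \<forall>h>0. h < d \<longrightarrow> ln (expo_mass (\<mu> + h)) + (\<mu> + h) * \<gamma> < ln (expo_mass \<mu>) + \<mu> * \<gamma>"
    using DERIV_neg_dec_right[OF D[of \<gamma>]] assms by (simp add: \<gamma>_def)
  then obtain d2 where d2: "0 < d2"
    "\<And>h. 0 < h \<Longrightarrow> h < d2 \<Longrightarrow> ln (expo_mass (\<mu> + h)) + (\<mu> + h) * \<gamma> < ln (expo_mass \<mu>) + \<mu> * \<gamma>" by blast
  define s where "s = min (\<mu> / 2) (min (d1 / 2) (d2 / 2))"
  have s: "0 < s" "s < \<mu>" "s < d1" "s < d2" using assms d1(1) d2(1) by (auto simp: s_def min_def)
  define Z where "Z = expo_mass \<mu>"
  \<comment> \<open>\<open>r1\<close> and \<open>r2\<close> are the per-letter ratios of the tail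
    bounds to the total mass.\<close>
  define r1 where "r1 = exp (- s * \<beta>) * expo_mass (\<mu> - s) / Z"
  define r2 where "r2 = exp (s * \<gamma>) * expo_mass (\<mu> + s) / Z"
  have pos: "0 < Z" "0 < expo_mass (\<mu> - s)" "0 < expo_mass (\<mu> + s)"
    unfolding Z_def using s assms by (auto intro!: expo_mass_pos)
  have "r1 = exp (ln (expo_mass (\<mu> - s)) - s * \<beta> - ln Z)"
    using pos by (simp add: r1_def exp_diff exp_minus exp_add field_simps)
  also have "\<dots> < 1" using d1(2)[OF s(1,3)] by (simp add: Z_def algebra_simps)
  finally have r1: "0 \<le> r1" "r1 < 1" using pos by (auto simp: r1_def)
  have "r2 = exp (ln (expo_mass (\<mu> + s)) + s * \<gamma> - ln Z)"
    using pos by (simp add: r2_def exp_diff exp_add field_simps)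
  also have "\<dots> < 1" using d2(2)[OF s(1,4)] by (simp add: Z_def algebra_simps)
  finally have r2: "0 \<le> r2" "r2 < 1" using pos by (auto simp: r2_def)
  have "(\<lambda>n. r1 ^ n + r2 ^ n) \<longlonglongrightarrow> 0 + 0"
    using r1 r2 by (intro tendsto_add LIMSEQ_realpow_zero)
  then have "\<forall>\<^sub>F n in sequentially. r1 ^ n + r2 ^ n < 1 / 2"
    by (rule order_tendstoD) simp
  then show ?thesis
  proof eventually_elim
    case (elim n)
    let ?v = "measure (PiM {..<n} (\<lambda>_. lborel)) (cost_ball n \<alpha> A)"
    have "ennreal ((A * Z) ^ n) \<le> ennreal (exp (- \<mu> * \<gamma>) ^ n * ?v
       + (A * (exp (- s * \<beta>) * expo_mass (\<mu> - s))) ^ n + (A * (exp (s * \<gamma>) * expo_mass (\<mu> + s))) ^ n)"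
      using emeasure_cost_ball_ge[of A s \<mu> \<beta> \<alpha> n \<gamma>] assms s pos emeasure_cost_ball_finite[of n \<alpha> A]
      by (simp add: \<beta>_def Z_def emeasure_eq_ennreal_measure ennreal_mult[symmetric] ennreal_plus[symmetric]
           less_top[symmetric] del: ennreal_plus)
    then have "(A * Z) ^ n \<le> exp (- \<mu> * \<gamma>) ^ n * ?v
       + (A * (exp (- s * \<beta>) * expo_mass (\<mu> - s))) ^ n + (A * (exp (s * \<gamma>) * expo_mass (\<mu> + s))) ^ n"
      using assms pos by (subst (asm) ennreal_le_iff) auto
    also have "A * (exp (- s * \<beta>) * expo_mass (\<mu> - s)) = A * Z * r1" using pos by (simp add: r1_def)
    also have "A * (exp (s * \<gamma>) * expo_mass (\<mu> + s)) = A * Z * r2" using pos by (simp add: r2_def)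
    finally have *: "(A * Z) ^ n \<le> exp (- \<mu> * \<gamma>) ^ n * ?v + (A * Z) ^ n * (r1 ^ n + r2 ^ n)"
      by (simp add: power_mult_distrib algebra_simps)
    have "(A * Z) ^ n * (r1 ^ n + r2 ^ n) \<le> (A * Z) ^ n * (1 / 2)"
      using elim assms pos by (intro mult_left_mono) auto
    with * have "(A * Z) ^ n / 2 \<le> exp (- \<mu> * \<gamma>) ^ n * ?v" by simp
    then have "exp (\<mu> * \<gamma>) ^ n * ((A * Z) ^ n / 2) \<le> exp (\<mu> * \<gamma>) ^ n * (exp (- \<mu> * \<gamma>) ^ n * ?v)"
      by (intro mult_left_mono) auto
    also have "\<dots> = ?v"
      by (simp add: mult.assoc[symmetric] power_mult_distrib[symmetric] exp_add[symmetric])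
    finally show ?case by (simp add: Z_def \<gamma>_def power_mult_distrib mult_ac)
  qed
qed

subsection \<open>Achievable rates\<close>

lemma num_msgs_pos: "0 < num_msgs n R"
  by (simp add: num_msgs_def)

text \<open>Only wrong messages enter the union bound; leaving out the correct one absorbs the
  rounding in \<open>num_msgs\<close>, so no constant factor is lost.\<close>

lemma num_msgs_le: "real (num_msgs n R) - 1 \<le> (2 powr R) ^ n"
proof -
  have "0 \<le> 2 powr (real n * R)" by simp
  then have "real (num_msgs n R) = of_int \<lceil>2 powr (real n * R)\<rceil>"
    unfolding num_msgs_def by (simp add: order.trans[OF _ le_of_int_ceiling])
  also have "\<dots> - 1 \<le> 2 powr (real n * R)" by linarith
  also have "\<dots> = (2 powr R) ^ n" by (simp add: powr_powr[symmetric] powr_realpow mult.commute)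
  finally show ?thesis .
qed

lemma avg_err_nonneg: "0 \<le> avg_err n \<sigma> a b x y M L g"
  unfolding avg_err_def by (intro divide_nonneg_nonneg sum_nonneg) auto

lemma valid_enc_cost_ball:
  assumes "\<And>m. m \<in> {1..M} \<Longrightarrow> x m \<in> cost_ball n \<alpha> A"
  shows "valid_enc n M \<alpha> A x"
  using assms unfolding valid_enc_def cost_ball_def by fastforce

text \<open>Random codebooks and distance decoding at a single block length. The factor 4 in
  \<open>E\<close> combines the 2 from the volume bound \<open>V ^ n / 2\<close> with the 2 from the
  first-moment argument.\<close>

lemma ex_code:
  fixes \<sigma> \<rho> \<tau> A \<alpha> h11 h12 h21 h22 R1 R2 V :: real
  defines "W \<equiv> sqrt (2 * pi * exp 1 * \<tau>)"
  assumes "0 < \<sigma>" "\<sigma> < \<rho>" "0 < \<tau>" "0 < h11" "0 < h12" "0 < h21" "0 < h22" "0 < V"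
    and vol: "V ^ n / 2 \<le> measure (PiM {..<n} (\<lambda>_. lborel)) (cost_ball n \<alpha> A)"
  defines "E \<equiv> (\<rho> / \<sigma> * exp (- (1 / \<sigma>\<^sup>2 - 1 / \<rho>\<^sup>2) / 2 * \<tau>)) ^ n
      + 4 * ((2 powr R1 * W / (h11 * V)) ^ n + (2 powr (R1 + R2) * W / (max h11 h21 * V)) ^ n
      + (2 powr R2 * W / (h22 * V)) ^ n + (2 powr (R1 + R2) * W / (max h22 h12 * V)) ^ n + (1 / 2) ^ n)"
  shows "\<exists>x1 x2 g1 g2. valid_enc n (num_msgs n R1) \<alpha> A x1 \<and> valid_enc n (num_msgs n R2) \<alpha> A x2
      \<and> valid_dec n g1 \<and> valid_dec n g2
      \<and> avg_err n \<sigma> h11 h21 x1 x2 (num_msgs n R1) (num_msgs n R2) g1 \<le> E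
      \<and> avg_err n \<sigma> h22 h12 x2 x1 (num_msgs n R2) (num_msgs n R1) g2 \<le> E"
proof -
  define v where "v = measure (PiM {..<n} (\<lambda>_. lborel :: real measure)) (cost_ball n \<alpha> A)"
  define M where "M = (\<lambda>p. if p then num_msgs n R1 else num_msgs n R2)"
  define R where "R = (\<lambda>p. if p then R1 else R2)"
  have "0 < V ^ n" using assms by simp
  then have v: "0 < v" "V ^ n / 2 \<le> v" using vol unfolding v_def by linarith+
  interpret random_codebook n "cost_ball n \<alpha> A" v M \<sigma> \<tau>
    using cost_ball_sets[of n \<alpha> A] emeasure_cost_ball_finite[of n \<alpha> A] v assms
    by unfold_locales (auto simp: v_def M_def num_msgs_pos emeasure_eq_ennreal_measure)
  have W: "random_codebook.W \<tau> = W"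
    unfolding W_def by (simp add: assms(1))
  have Wpos: "0 < W" using assms by simp
  have div_v: "t ^ n / v \<le> 2 * (t / V) ^ n" if "0 \<le> t" for t
  proof -
    have "t ^ n / v \<le> t ^ n / (V ^ n / 2)" using v that assms by (intro divide_left_mono) auto
    then show ?thesis by (simp add: power_divide mult.commute)
  qed
  have Mle: "real (M p) - 1 \<le> (2 powr R p) ^ n" for p
    using num_msgs_le by (simp add: M_def R_def)
  have bound: "confusion_bound p a b \<le> 2 * ((2 powr R p * W / (a * V)) ^ n + (2 powr (R1 + R2) * W / (max a b * V)) ^ n)"
    if ab: "0 < a" "0 < b" for p a b
  proof -
    have 1: "(W / a) ^ n / v \<le> 2 * (W / (a * V)) ^ n"
      using div_v[of "W / a"] ab Wpos by simp
    have 2: "(W / max a b) ^ n / v \<le> 2 * (W / (max a b * V)) ^ n"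
      using div_v[of "W / max a b"] ab Wpos by simp
    have Mp: "0 \<le> real (M p) - 1" "0 \<le> real (M (\<not> p)) - 1"
      using M_pos[of p] M_pos[of "\<not> p"] by auto
    have "confusion_bound p a b \<le> (2 powr R p) ^ n * (2 * (W / (a * V)) ^ n
        + (2 powr R (\<not> p)) ^ n * (2 * (W / (max a b * V)) ^ n))"
      unfolding confusion_bound_def W using ab Wpos v assms
      by (intro mult_mono add_mono 1 2 Mle Mp add_nonneg_nonneg mult_nonneg_nonneg) auto
    also have "\<dots> = 2 * ((2 powr R p * W / (a * V)) ^ n + (2 powr R p * 2 powr R (\<not> p) * W / (max a b * V)) ^ n)"
      by (simp add: power_mult_distrib power_divide algebra_simps)
    also have "2 powr R p * 2 powr R (\<not> p) = 2 powr (R1 + R2)"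
      by (simp add: R_def powr_add)
    finally show ?thesis .
  qed
  \<comment> \<open>Halving compensates the factor 2 of \<open>ex_codebook\<close>. The summand
    \<open>(1 / 2) ^ n\<close> in \<open>E\<close> makes the required inequality strict.\<close>
  define B where "B = (E - (\<rho> / \<sigma> * exp (- (1 / \<sigma>\<^sup>2 - 1 / \<rho>\<^sup>2) / 2 * \<tau>)) ^ n) / 2"
  have "confusion_bound True h11 h21 + confusion_bound False h22 h12 < B"
  proof -
    have arith: "a + b < (q + 4 * (t1 + t2 + t3 + t4 + e) - q) / 2"
      if "a \<le> 2 * (t1 + t2)" "b \<le> 2 * (t3 + t4)" "0 < e" for a b q e t1 t2 t3 t4 :: real
      using that by simp
    show ?thesis
      using bound[OF assms(5,7), of True] bound[OF assms(8,6), of False]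
      unfolding B_def E_def R_def if_True if_False by (intro arith) auto
  qed
  from ex_codebook[OF _ _ _ _ this] assms obtain x where
    x: "\<And>p m. m \<in> {1..M p} \<Longrightarrow> x p m \<in> cost_ball n \<alpha> A"
    and c: "mean_confusion True h11 h21 (case_prod x) \<le> 2 * B" "mean_confusion False h22 h12 (case_prod x) \<le> 2 * B"
    by blast
  obtain g1 where g1: "valid_dec n g1" and e1: "avg_err n \<sigma> h11 h21 (x True) (x False) (M True) (M False) g1
     \<le> (\<rho> / \<sigma> * exp (- (1 / \<sigma>\<^sup>2 - 1 / \<rho>\<^sup>2) / 2 * \<tau>)) ^ n + mean_confusion True h11 h21 (case_prod x)"
    using ex_decoder[OF assms(2-4), of n h11 h21 "x True" "x False" "M True" "M False"]
    unfolding mean_confusion_def confusion_def by auto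
  obtain g2 where g2: "valid_dec n g2" and e2: "avg_err n \<sigma> h22 h12 (x False) (x True) (M False) (M True) g2
     \<le> (\<rho> / \<sigma> * exp (- (1 / \<sigma>\<^sup>2 - 1 / \<rho>\<^sup>2) / 2 * \<tau>)) ^ n + mean_confusion False h22 h12 (case_prod x)"
    using ex_decoder[OF assms(2-4), of n h22 h12 "x False" "x True" "M False" "M True"]
    unfolding mean_confusion_def confusion_def by auto
  have "valid_enc n (M p) \<alpha> A (x p)" for p
    using x by (rule valid_enc_cost_ball)
  from this[of True] this[of False] g1 g2 e1 e2 c show ?thesis
    by (intro exI[of _ "x True"] exI[of _ "x False"] exI[of _ g1] exI[of _ g2]) (auto simp: M_def B_def)
qed

text \<open>The rate conditions are strict at noise level \<open>\<sigma>\<^sup>2\<close>, so by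
  continuity they persist for some \<tau> slightly above it. Every term of the error bound is then a
  geometric sequence with ratio below 1.\<close>

lemma achievable_of_volume:
  fixes \<sigma> A \<alpha> h11 h12 h21 h22 R1 R2 V :: real
  defines "w \<equiv> sqrt (2 * pi * exp 1 * \<sigma>\<^sup>2)"
  assumes "0 < \<sigma>" "0 < A" "0 < \<alpha>" "0 < h11" "0 < h12" "0 < h21" "0 < h22" "0 < V"
    and vol: "\<forall>\<^sub>F n in sequentially. V ^ n / 2 \<le> measure (PiM {..<n} (\<lambda>_. lborel)) (cost_ball n \<alpha> A)"
    and rate: "2 powr R1 * w < h11 * V" "2 powr R2 * w < h22 * V"
      "2 powr (R1 + R2) * w < max h11 h21 * V" "2 powr (R1 + R2) * w < max h22 h12 * V"
  shows "achievable \<sigma> A \<alpha> \<alpha> h11 h12 h21 h22 R1 R2"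
proof -
  define W where "W = (\<lambda>\<tau>. sqrt (2 * pi * exp 1 * \<tau>))"
  have "((\<lambda>\<tau>. c * W \<tau>) \<longlongrightarrow> c * w) (at_right (\<sigma>\<^sup>2))" for c
    unfolding W_def w_def by (intro tendsto_intros)
  then have ev: "\<forall>\<^sub>F \<tau> in at_right (\<sigma>\<^sup>2). c * W \<tau> < d" if "c * w < d" for c d
    using that by (rule order_tendstoD(2))
  have "\<forall>\<^sub>F \<tau> in at_right (\<sigma>\<^sup>2). \<sigma>\<^sup>2 < \<tau> \<and> 2 powr R1 * W \<tau> < h11 * V \<and> 2 powr R2 * W \<tau> < h22 * V
     \<and> 2 powr (R1 + R2) * W \<tau> < max h11 h21 * V \<and> 2 powr (R1 + R2) * W \<tau> < max h22 h12 * V"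
    by (intro eventually_conj ev rate eventually_at_right_less)
  then obtain \<tau> where \<tau>: "\<sigma>\<^sup>2 < \<tau>" and rate': "2 powr R1 * W \<tau> < h11 * V" "2 powr R2 * W \<tau> < h22 * V"
     "2 powr (R1 + R2) * W \<tau> < max h11 h21 * V" "2 powr (R1 + R2) * W \<tau> < max h22 h12 * V"
    using eventually_happens'[OF trivial_limit_at_right_real] by blast
  \<comment> \<open>The midpoint gives \<open>\<sigma>\<^sup>2 < \<rho>\<^sup>2 < \<tau>\<close>, as
    the Chernoff bound requires.\<close>
  define \<rho> where "\<rho> = sqrt ((\<sigma>\<^sup>2 + \<tau>) / 2)"
  have \<tau>_pos: "0 < \<tau>" using \<tau> by (meson le_less_trans zero_le_power2)
  have \<rho>: "\<sigma> < \<rho>" "\<rho>\<^sup>2 < \<tau>"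
    using \<tau> \<tau>_pos assms unfolding \<rho>_def by (auto intro!: real_less_rsqrt)
  define q where "q = \<rho> / \<sigma> * exp (- (1 / \<sigma>\<^sup>2 - 1 / \<rho>\<^sup>2) / 2 * \<tau>)"
  have q: "0 \<le> q" "q < 1"
    using gaussian_exp_square_less_1[OF assms(2) \<rho>] \<rho> assms unfolding q_def by auto
  define E where "E = (\<lambda>n. q ^ n + 4 * ((2 powr R1 * W \<tau> / (h11 * V)) ^ n
      + (2 powr (R1 + R2) * W \<tau> / (max h11 h21 * V)) ^ n
      + (2 powr R2 * W \<tau> / (h22 * V)) ^ n + (2 powr (R1 + R2) * W \<tau> / (max h22 h12 * V)) ^ n + (1 / 2) ^ n))"
  have W0: "0 \<le> W \<tau>" using \<tau>_pos by (simp add: W_def)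
  have "E \<longlonglongrightarrow> 0 + 4 * (0 + 0 + 0 + 0 + 0)"
    unfolding E_def using q rate' W0 assms
    by (intro tendsto_add tendsto_mult tendsto_const LIMSEQ_realpow_zero) (auto simp: divide_less_eq_1)
  then have E: "E \<longlonglongrightarrow> 0" by simp
  define good where "good = (\<lambda>n. V ^ n / 2 \<le> measure (PiM {..<n} (\<lambda>_. lborel :: real measure)) (cost_ball n \<alpha> A))"
  have "\<exists>x1 x2 g1 g2. valid_enc n (num_msgs n R1) \<alpha> A x1 \<and> valid_enc n (num_msgs n R2) \<alpha> A x2
      \<and> valid_dec n g1 \<and> valid_dec n g2 \<and> (good n \<longrightarrow>
        avg_err n \<sigma> h11 h21 x1 x2 (num_msgs n R1) (num_msgs n R2) g1 \<le> E n
      \<and> avg_err n \<sigma> h22 h12 x2 x1 (num_msgs n R2) (num_msgs n R1) g2 \<le> E n)" for n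
  proof (cases "good n")
    case True
    then show ?thesis
      using ex_code[of \<sigma> \<rho> \<tau> h11 h12 h21 h22 V n \<alpha> A R1 R2] assms \<rho> \<tau>_pos
      unfolding good_def E_def q_def W_def by blast
  next
    case False
    \<comment> \<open>Achievability asks for valid codes at every length. At the finitely many
      lengths where the volume bound fails, the all-zero code is a default.\<close>
    have "valid_enc n M \<alpha> A (\<lambda>_ _. 0)" for M
      using assms by (auto simp: valid_enc_def)
    moreover have "valid_dec n (\<lambda>_. 0)" by (simp add: valid_dec_def)
    ultimately show ?thesis using False by blast
  qed
  then obtain x1 x2 g1 g2 where code: "\<And>n. valid_enc n (num_msgs n R1) \<alpha> A (x1 n) \<and> valid_enc n (num_msgs n R2) \<alpha> A (x2 n)
      \<and> valid_dec n (g1 n) \<and> valid_dec n (g2 n) \<and> (good n \<longrightarrow>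
        avg_err n \<sigma> h11 h21 (x1 n) (x2 n) (num_msgs n R1) (num_msgs n R2) (g1 n) \<le> E n
      \<and> avg_err n \<sigma> h22 h12 (x2 n) (x1 n) (num_msgs n R2) (num_msgs n R1) (g2 n) \<le> E n)"
    by metis
  have good: "\<forall>\<^sub>F n in sequentially. good n" using vol by (simp add: good_def)
  have "(\<lambda>n. avg_err n \<sigma> h11 h21 (x1 n) (x2 n) (num_msgs n R1) (num_msgs n R2) (g1 n)) \<longlonglongrightarrow> 0"
    by (rule tendsto_sandwich[OF _ _ tendsto_const E]) (use code avg_err_nonneg in \<open>auto intro: eventually_mono[OF good]\<close>)
  moreover have "(\<lambda>n. avg_err n \<sigma> h22 h12 (x2 n) (x1 n) (num_msgs n R2) (num_msgs n R1) (g2 n)) \<longlonglongrightarrow> 0"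
    by (rule tendsto_sandwich[OF _ _ tendsto_const E]) (use code avg_err_nonneg in \<open>auto intro: eventually_mono[OF good]\<close>)
  ultimately show ?thesis
    unfolding achievable_def using code by blast
qed

subsection \<open>Estimates for Cbar\<close>

abbreviation "std_gauss \<equiv> density lborel (\<lambda>x. ennreal (std_normal_density x))"

lemma prob_space_std_gauss: "prob_space std_gauss"
  by (rule prob_space_normal_density) simp

lemma Qfun_std_normal: "Qfun x = measure std_gauss {x<..}"
proof -
  interpret prob_space std_gauss by (rule prob_space_std_gauss)
  have int: "integrable lborel (\<lambda>t. indicator {x<..} t * std_normal_density t)"
    using integrable_real_mult_indicator[of "{x<..}" lborel std_normal_density]
    by (simp add: mult.commute)
  have "ennreal (measure std_gauss {x<..}) = (\<integral>\<^sup>+t. ennreal (indicator {x<..} t * std_normal_density t) \<partial>lborel)"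
    unfolding emeasure_eq_measure[symmetric]
    by (subst emeasure_density) (auto intro!: nn_integral_cong split: split_indicator)
  also have "\<dots> = ennreal (LINT t|lborel. indicator {x<..} t * std_normal_density t)"
    by (intro nn_integral_eq_integral int) auto
  finally show ?thesis
    by (simp add: Qfun_def set_lebesgue_integral_def std_normal_density_def integral_nonneg)
qed

lemma Qfun_nonneg: "0 \<le> Qfun x"
  by (simp add: Qfun_std_normal)

lemma Qfun_tendsto_0: "(Qfun \<longlongrightarrow> 0) at_top"
proof -
  interpret prob_space std_gauss by (rule prob_space_std_gauss)
  interpret real_distribution std_gauss by standard auto
  have "Qfun x = 1 - cdf std_gauss x" for x
  proof -
    have "{x<..} = space std_gauss - {..x}" by auto
    moreover have "prob (space std_gauss - {..x}) = 1 - prob {..x}"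
      by (rule prob_compl) simp
    ultimately show ?thesis
      by (simp only: Qfun_std_normal cdf_def)
  qed
  then have "Qfun = (\<lambda>x. 1 - cdf std_gauss x)" by auto
  moreover have "((\<lambda>x. 1 - cdf std_gauss x) \<longlongrightarrow> 1 - 1) at_top"
    by (intro tendsto_diff tendsto_const cdf_lim_at_top_prob)
  ultimately show ?thesis by simp
qed

text \<open>Reflection symmetry gives both tails the same mass.\<close>

lemma Qfun_eq_central:
  assumes "0 \<le> x"
  shows "1 - 2 * Qfun x = measure std_gauss {-x..x}"
proof -
  interpret prob_space std_gauss by (rule prob_space_std_gauss)
  have "emeasure std_gauss {..<-x} = (\<integral>\<^sup>+t. ennreal (std_normal_density t) * indicator {..<-x} t \<partial>lborel)"
    by (simp add: emeasure_density)
  also have "\<dots> = (\<integral>\<^sup>+t. ennreal (std_normal_density t) * indicator {x<..} t \<partial>lborel)"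
    by (subst nn_integral_real_affine[where c="-1" and t=0])
       (auto simp: std_normal_density_def indicator_def intro!: nn_integral_cong)
  also have "\<dots> = emeasure std_gauss {x<..}"
    by (simp add: emeasure_density)
  finally have sym: "measure std_gauss {..<-x} = Qfun x"
    by (simp add: Qfun_std_normal measure_def)
  have "1 = measure std_gauss ({..<-x} \<union> {-x..x} \<union> {x<..})"
  proof -
    have "{..<-x} \<union> {-x..x} \<union> {x<..} = space std_gauss" using assms by auto
    then show ?thesis by (simp only: prob_space)
  qed
  also have "\<dots> = measure std_gauss {..<-x} + measure std_gauss {-x..x} + measure std_gauss {x<..}"
    using assms by (subst finite_measure_Union; (subst finite_measure_Union)?; auto)
  finally show ?thesis by (simp add: sym Qfun_std_normal[symmetric])
qed

text \<open>On the central interval of length \<open>2 * x\<close> the density lies between its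
  value at \<open>x\<close> and \<open>1 / 2\<close>, the latter because
  \<open>sqrt (2 * pi)\<close> is at least 2.\<close>

lemma Qfun_central_bounds:
  assumes "0 < x"
  shows "0 < 1 - 2 * Qfun x" and "1 - 2 * Qfun x \<le> x" and "1 - 2 * Qfun x \<le> 1"
proof -
  interpret prob_space std_gauss by (rule prob_space_std_gauss)
  have eq: "ennreal (1 - 2 * Qfun x) = (\<integral>\<^sup>+t. ennreal (std_normal_density t) * indicator {-x..x} t \<partial>lborel)"
    unfolding Qfun_eq_central[OF less_imp_le[OF assms]] emeasure_eq_measure[symmetric]
    by (simp add: emeasure_density)
  have int: "(\<integral>\<^sup>+t. ennreal c * indicator {-x..x} t \<partial>lborel) = ennreal (c * (2 * x))" if "0 \<le> c" for c
    using that assms by (subst nn_integral_cmult_indicator) (auto simp: ennreal_mult)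
  have "1 / sqrt (2 * pi) \<le> 1 / 2"
    using pi_ge_two by (simp add: field_simps real_le_rsqrt)
  then have le: "std_normal_density t \<le> 1 / 2" for t
    unfolding std_normal_density_def by (intro order_trans[OF mult_left_le]) auto
  have "ennreal (1 - 2 * Qfun x) \<le> (\<integral>\<^sup>+t. ennreal (1 / 2) * indicator {-x..x} t \<partial>lborel)"
    unfolding eq by (intro nn_integral_mono mult_right_mono ennreal_leI le) auto
  also have "\<dots> = ennreal x" by (subst int) auto
  finally show "1 - 2 * Qfun x \<le> x" using assms by (subst (asm) ennreal_le_iff) auto
  have ge: "std_normal_density x \<le> std_normal_density t" if "t \<in> {-x..x}" for t
    using that assms unfolding std_normal_density_def
    by (auto intro!: divide_right_mono power2_le_iff_abs_le[THEN iffD2])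
  have pos: "0 < std_normal_density x * (2 * x)"
    using assms normal_density_pos[of 1 0 x] by simp
  have "ennreal (std_normal_density x * (2 * x)) = (\<integral>\<^sup>+t. ennreal (std_normal_density x) * indicator {-x..x} t \<partial>lborel)"
    by (subst int) auto
  also have "\<dots> \<le> ennreal (1 - 2 * Qfun x)"
    unfolding eq by (intro nn_integral_mono) (auto split: split_indicator intro!: ennreal_leI ge)
  finally show "0 < 1 - 2 * Qfun x"
    using pos by (simp only: ennreal_le_iff2) linarith
  show "1 - 2 * Qfun x \<le> 1" using Qfun_nonneg[of x] by simp
qed

text \<open>A bound independent of \<xi>: it shows that the infimum in \<open>Cbar\<close> is over a
  set bounded below, so that \<open>Cbar\<close> really lies below each value of the objective. The
  absolute value covers a negative logarithm, whose weight is only known to lie between 0 and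
  1.\<close>

lemma c2_obj_ge:
  assumes "0 < \<sigma>" "0 < A" "0 < \<xi>"
  shows "- \<bar>log 2 (A / (\<sigma> * sqrt (2 * pi)))\<bar> - log 2 (exp 1) / 2 \<le> c2_obj \<sigma> A \<xi>"
proof -
  let ?\<kappa> = "A / (\<sigma> * sqrt (2 * pi))"
  let ?p = "1 - 2 * Qfun ((\<xi> + A / 2) / \<sigma>)"
  let ?D = "1 - 2 * Qfun (\<xi> / \<sigma>)"
  let ?arg = "(A + 2 * \<xi>) / (\<sigma> * sqrt (2 * pi) * ?D)"
  have p: "0 \<le> ?p" "?p \<le> 1"
    using Qfun_central_bounds[of "(\<xi> + A / 2) / \<sigma>"] assms by auto
  have D: "0 < ?D" "?D \<le> 1" using Qfun_central_bounds[of "\<xi> / \<sigma>"] assms by auto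
  \<comment> \<open>The numerator drops \<open>2 * \<xi>\<close>, and the central probability in the
    denominator is at most 1.\<close>
  have "?\<kappa> \<le> ?arg"
  proof (rule frac_le)
    show "\<sigma> * sqrt (2 * pi) * ?D \<le> \<sigma> * sqrt (2 * pi)"
      using D assms by (intro mult_left_le) auto
    show "0 < \<sigma> * sqrt (2 * pi) * ?D" using D assms by simp
  qed (use assms in auto)
  moreover have "0 < ?\<kappa>" using assms by simp
  ultimately have "log 2 ?\<kappa> \<le> log 2 ?arg"
    by (meson log_le_cancel_iff one_less_numeral_iff order.strict_trans2 semiring_norm(76))
  then have "?p * log 2 ?\<kappa> \<le> ?p * log 2 ?arg" using p by (intro mult_left_mono)
  moreover have "\<bar>?p * log 2 ?\<kappa>\<bar> \<le> \<bar>log 2 ?\<kappa>\<bar>"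
    unfolding abs_mult using p by (intro mult_left_le_one_le) auto
  moreover have "log 2 (exp 1) * (- 1 / 2) \<le> log 2 (exp 1) *
     (- 1 / 2 + Qfun (\<xi> / \<sigma>) + \<xi> / (sqrt (2 * pi) * \<sigma>) * exp (- (\<xi>\<^sup>2) / (2 * \<sigma>\<^sup>2)))"
    using assms Qfun_nonneg[of "\<xi> / \<sigma>"] by (intro mult_left_mono) (auto simp: log_def add_nonneg_nonneg)
  ultimately show ?thesis unfolding c2_obj_def by linarith
qed

text \<open>With \<open>s = \<mu> * \<xi> / A\<close> the difference of exponentials is at least
  \<open>s\<close>, and at least \<open>\<mu> / 2\<close> for small \<mu>. In the first case the
  central probability is bounded by \<open>\<xi> / \<sigma>\<close>, which cancels \<xi> and \<mu>;
  in the second by 1.\<close>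

lemma c1_log_argument_ge:
  assumes "0 < \<sigma>" "0 < A" "0 < \<mu>" "0 < \<xi>"
  shows "min (1 / sqrt (2 * pi)) (A / (2 * \<sigma> * sqrt (2 * pi)))
    \<le> (A / \<sigma>) * (exp (\<mu> * \<xi> / A) - exp (- \<mu> * (1 + \<xi> / A)))
         / (sqrt (2 * pi) * \<mu> * (1 - 2 * Qfun (\<xi> / \<sigma>)))"
proof -
  let ?D = "1 - 2 * Qfun (\<xi> / \<sigma>)"
  define s where "s = \<mu> * \<xi> / A"
  have s: "0 < s" using assms by (simp add: s_def)
  have D: "0 < ?D" "?D \<le> 1" "?D \<le> \<xi> / \<sigma>" using Qfun_central_bounds[of "\<xi> / \<sigma>"] assms by auto
  have es: "- \<mu> * (1 + \<xi> / A) = - \<mu> - s" by (simp add: s_def algebra_simps)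
  have num: "exp s - exp (- \<mu> - s) \<ge> 1 + s - exp (- \<mu>)"
    using exp_ge_add_one_self[of s] s by (smt (verit) exp_le_cancel_iff)
  have "exp (- \<mu>) \<le> 1" using assms by simp
  with num have num': "s \<le> exp s - exp (- \<mu> - s)" by linarith
  show ?thesis
  proof (cases "1 \<le> \<mu>")
    case True
    have "1 / sqrt (2 * pi) = (A / \<sigma>) * s / (sqrt (2 * pi) * \<mu> * (\<xi> / \<sigma>))"
      using assms by (simp add: s_def)
    also have "\<dots> \<le> (A / \<sigma>) * (exp s - exp (- \<mu> - s)) / (sqrt (2 * pi) * \<mu> * ?D)"
      using assms num' D s by (intro frac_le mult_left_mono mult_nonneg_nonneg mult_pos_pos) auto
    finally show ?thesis unfolding es s_def by linarith
  next
    case False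
    have "1 + \<mu> \<le> exp \<mu>" by simp
    then have "exp (- \<mu>) \<le> 1 / (1 + \<mu>)" using assms by (simp add: exp_minus field_simps)
    also have "\<dots> \<le> 1 - \<mu> / 2" using assms False by (simp add: field_simps)
    finally have "\<mu> / 2 \<le> exp s - exp (- \<mu> - s)" using num s by linarith
    moreover have "A / (2 * \<sigma> * sqrt (2 * pi)) = (A / \<sigma>) * (\<mu> / 2) / (sqrt (2 * pi) * \<mu> * 1)"
      using assms by simp
    moreover have "(A / \<sigma>) * (\<mu> / 2) / (sqrt (2 * pi) * \<mu> * 1)
        \<le> (A / \<sigma>) * (exp s - exp (- \<mu> - s)) / (sqrt (2 * pi) * \<mu> * ?D)"
      using assms calculation(1) D s by (intro frac_le mult_left_mono mult_nonneg_nonneg mult_pos_pos) auto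
    ultimately show ?thesis unfolding es s_def by linarith
  qed
qed

text \<open>The counterpart of \<open>c2_obj_ge\<close>, uniform in both parameters. All terms of
  the second bracket other than \<open>- 1 / 2\<close> are nonnegative.\<close>

lemma c1_obj_ge:
  assumes "0 < \<sigma>" "0 < A" "0 < \<alpha>" "\<alpha> < 1" "0 < \<mu>" "0 < \<xi>"
  shows "- \<bar>log 2 (min (1 / sqrt (2 * pi)) (A / (2 * \<sigma> * sqrt (2 * pi))))\<bar> - log 2 (exp 1) / 2
    \<le> c1_obj \<sigma> A \<alpha> \<mu> \<xi>"
proof -
  let ?\<kappa> = "min (1 / sqrt (2 * pi)) (A / (2 * \<sigma> * sqrt (2 * pi)))"
  let ?p = "1 - Qfun ((\<xi> + \<alpha> * A) / \<sigma>) - Qfun ((\<xi> + (1 - \<alpha>) * A) / \<sigma>)"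
  let ?arg = "(A / \<sigma>) * (exp (\<mu> * \<xi> / A) - exp (- \<mu> * (1 + \<xi> / A)))
         / (sqrt (2 * pi) * \<mu> * (1 - 2 * Qfun (\<xi> / \<sigma>)))"
  have p: "0 \<le> ?p" "?p \<le> 1"
    using Qfun_central_bounds(1)[of "(\<xi> + \<alpha> * A) / \<sigma>"] Qfun_central_bounds(1)[of "(\<xi> + (1 - \<alpha>) * A) / \<sigma>"]
      Qfun_nonneg[of "(\<xi> + \<alpha> * A) / \<sigma>"] Qfun_nonneg[of "(\<xi> + (1 - \<alpha>) * A) / \<sigma>"] assms
    by (auto simp: add_pos_pos)
  have "0 < ?\<kappa>" using assms by auto
  moreover have "?\<kappa> \<le> ?arg" using assms by (intro c1_log_argument_ge)
  ultimately have "log 2 ?\<kappa> \<le> log 2 ?arg"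
    by (meson log_le_cancel_iff one_less_numeral_iff order.strict_trans2 semiring_norm(76))
  then have "?p * log 2 ?\<kappa> \<le> ?p * log 2 ?arg" using p by (intro mult_left_mono)
  moreover have "\<bar>?p * log 2 ?\<kappa>\<bar> \<le> \<bar>log 2 ?\<kappa>\<bar>"
    unfolding abs_mult using p by (intro mult_left_le_one_le) auto
  moreover have "log 2 (exp 1) * (- 1 / 2) \<le> log 2 (exp 1) *
       (- 1 / 2 + Qfun (\<xi> / \<sigma>)
        + \<xi> / (sqrt (2 * pi) * \<sigma>) * exp (- (\<xi>\<^sup>2) / (2 * \<sigma>\<^sup>2))
        + (\<sigma> / A) * (\<mu> / sqrt (2 * pi)) *
            (exp (- (\<xi>\<^sup>2) / (2 * \<sigma>\<^sup>2)) - exp (- ((A + \<xi>)\<^sup>2) / (2 * \<sigma>\<^sup>2)))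
        + \<mu> * \<alpha> * (1 - 2 * Qfun ((\<xi> + A / 2) / \<sigma>)))"
  proof (intro mult_left_mono)
    have "0 \<le> \<xi> / (sqrt (2 * pi) * \<sigma>) * exp (- (\<xi>\<^sup>2) / (2 * \<sigma>\<^sup>2))" using assms by simp
    moreover have "0 \<le> (\<sigma> / A) * (\<mu> / sqrt (2 * pi)) *
            (exp (- (\<xi>\<^sup>2) / (2 * \<sigma>\<^sup>2)) - exp (- ((A + \<xi>)\<^sup>2) / (2 * \<sigma>\<^sup>2)))"
      using assms by (intro mult_nonneg_nonneg) (auto intro!: divide_right_mono power_mono)
    moreover have "0 \<le> \<mu> * \<alpha> * (1 - 2 * Qfun ((\<xi> + A / 2) / \<sigma>))"
      using assms Qfun_central_bounds(1)[of "(\<xi> + A / 2) / \<sigma>"] by (intro mult_nonneg_nonneg) (auto simp: add_pos_pos)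
    ultimately show "- 1 / 2 \<le> - 1 / 2 + Qfun (\<xi> / \<sigma>)
        + \<xi> / (sqrt (2 * pi) * \<sigma>) * exp (- (\<xi>\<^sup>2) / (2 * \<sigma>\<^sup>2))
        + (\<sigma> / A) * (\<mu> / sqrt (2 * pi)) *
            (exp (- (\<xi>\<^sup>2) / (2 * \<sigma>\<^sup>2)) - exp (- ((A + \<xi>)\<^sup>2) / (2 * \<sigma>\<^sup>2)))
        + \<mu> * \<alpha> * (1 - 2 * Qfun ((\<xi> + A / 2) / \<sigma>))"
      using Qfun_nonneg[of "\<xi> / \<sigma>"] by linarith
  qed (simp add: log_def)
  ultimately show ?thesis unfolding c1_obj_def by linarith
qed

lemma Cbar_le_c1_obj:
  assumes "0 < \<sigma>" "0 < A" "0 < \<alpha>" "\<alpha> < 1 / 2" "0 < \<mu>" "0 < \<xi>"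
  shows "Cbar \<sigma> A \<alpha> \<le> c1_obj \<sigma> A \<alpha> \<mu> \<xi>"
proof -
  have "bdd_below ((\<lambda>(\<mu>, \<xi>). c1_obj \<sigma> A \<alpha> \<mu> \<xi>) ` ({0<..} \<times> {0<..}))"
    using assms by (intro bdd_belowI2) (auto intro!: c1_obj_ge)
  moreover have "c1_obj \<sigma> A \<alpha> \<mu> \<xi> \<in> (\<lambda>(\<mu>, \<xi>). c1_obj \<sigma> A \<alpha> \<mu> \<xi>) ` ({0<..} \<times> {0<..})"
    using assms by force
  ultimately show ?thesis
    using assms by (auto simp: Cbar_def intro: cInf_lower)
qed

lemma Cbar_le_c2_obj:
  assumes "0 < \<sigma>" "0 < A" "1 / 2 \<le> \<alpha>" "0 < \<xi>"
  shows "Cbar \<sigma> A \<alpha> \<le> c2_obj \<sigma> A \<xi>"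
proof -
  have "bdd_below (c2_obj \<sigma> A ` {0<..})"
    using assms by (intro bdd_belowI2) (auto intro!: c2_obj_ge)
  then show ?thesis
    using assms by (auto simp: Cbar_def intro: cInf_lower)
qed

subsection \<open>High signal-to-noise ratio\<close>

lemma mult_log2_le:
  assumes "p \<le> 1" "1 \<le> x"
  shows "p * log 2 x \<le> log 2 x"
  using mult_right_mono[OF assms(1), of "log 2 x"] assms(2) by simp

text \<open>Both objectives are evaluated at \<open>\<xi> = sqrt A\<close>, where the tail terms vanish in the limit.\<close>

lemma eventually_c1_obj_le:
  assumes "0 < \<sigma>" "0 < \<mu>" "0 < \<epsilon>"
  shows "\<forall>\<^sub>F A in at_top. c1_obj \<sigma> A \<alpha> \<mu> (sqrt A)
    \<le> log 2 (A / \<sigma>) - log 2 (2 * pi * exp 1) / 2 + (ln (expo_mass \<mu>) + \<mu> * \<alpha>) / ln 2 + \<epsilon>"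
proof -
  \<comment> \<open>\<open>g\<close> is the argument of the logarithm without its growing factor
    \<open>A / \<sigma>\<close>, and \<open>r\<close> is the second bracket; both converge.\<close>
  define g where "g = (\<lambda>A. (exp (\<mu> * sqrt A / A) - exp (- \<mu> * (1 + sqrt A / A)))
     / (sqrt (2 * pi) * \<mu> * (1 - 2 * Qfun (sqrt A / \<sigma>))))"
  define r where "r = (\<lambda>A. - 1 / 2 + Qfun (sqrt A / \<sigma>)
        + sqrt A / (sqrt (2 * pi) * \<sigma>) * exp (- ((sqrt A)\<^sup>2) / (2 * \<sigma>\<^sup>2))
        + (\<sigma> / A) * (\<mu> / sqrt (2 * pi)) *
            (exp (- ((sqrt A)\<^sup>2) / (2 * \<sigma>\<^sup>2)) - exp (- ((A + sqrt A)\<^sup>2) / (2 * \<sigma>\<^sup>2)))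
        + \<mu> * \<alpha> * (1 - 2 * Qfun ((sqrt A + A / 2) / \<sigma>)))"
  have Q1: "((\<lambda>A. Qfun (sqrt A / \<sigma>)) \<longlongrightarrow> 0) at_top"
    by (rule filterlim_compose[OF Qfun_tendsto_0]) (use assms in real_asymp)
  have Q2: "((\<lambda>A. Qfun ((sqrt A + A / 2) / \<sigma>)) \<longlongrightarrow> 0) at_top"
    by (rule filterlim_compose[OF Qfun_tendsto_0]) (use assms in real_asymp)
  have n: "((\<lambda>A. exp (\<mu> * sqrt A / A) - exp (- \<mu> * (1 + sqrt A / A))) \<longlongrightarrow> 1 - exp (- \<mu>)) at_top"
    using assms by real_asymp
  have "(g \<longlongrightarrow> (1 - exp (- \<mu>)) / (sqrt (2 * pi) * \<mu> * (1 - 2 * 0))) at_top"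
    unfolding g_def using assms by (intro tendsto_intros n Q1) auto
  then have g: "(g \<longlongrightarrow> expo_mass \<mu> / sqrt (2 * pi)) at_top"
    by (simp add: expo_mass_def mult.commute)
  have Zpos: "0 < expo_mass \<mu> / sqrt (2 * pi)" using expo_mass_pos[OF assms(2)] by simp
  have r1: "((\<lambda>A. sqrt A / (sqrt (2 * pi) * \<sigma>) * exp (- ((sqrt A)\<^sup>2) / (2 * \<sigma>\<^sup>2))) \<longlongrightarrow> 0) at_top"
    using assms by real_asymp
  have r2: "((\<lambda>A. (\<sigma> / A) * (\<mu> / sqrt (2 * pi)) *
            (exp (- ((sqrt A)\<^sup>2) / (2 * \<sigma>\<^sup>2)) - exp (- ((A + sqrt A)\<^sup>2) / (2 * \<sigma>\<^sup>2)))) \<longlongrightarrow> 0) at_top"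
    using assms by real_asymp
  have r: "(r \<longlongrightarrow> - 1 / 2 + 0 + 0 + 0 + \<mu> * \<alpha> * (1 - 2 * 0)) at_top"
    unfolding r_def by (intro tendsto_intros Q1 Q2 r1 r2)
  have lim: "((\<lambda>A. log 2 (g A) + log 2 (exp 1) * r A) \<longlongrightarrow>
      log 2 (expo_mass \<mu> / sqrt (2 * pi)) + log 2 (exp 1) * (- 1 / 2 + 0 + 0 + 0 + \<mu> * \<alpha> * (1 - 2 * 0))) at_top"
    using Zpos by (intro tendsto_intros g r) auto
  have "log 2 (expo_mass \<mu> / sqrt (2 * pi)) + log 2 (exp 1) * (- 1 / 2 + 0 + 0 + 0 + \<mu> * \<alpha> * (1 - 2 * 0))
      = - log 2 (2 * pi * exp 1) / 2 + (ln (expo_mass \<mu>) + \<mu> * \<alpha>) / ln 2"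
    using expo_mass_pos[OF assms(2)] by (simp add: log_def ln_div ln_mult ln_sqrt field_simps)
  with lim have "\<forall>\<^sub>F A in at_top. log 2 (g A) + log 2 (exp 1) * r A
      < - log 2 (2 * pi * exp 1) / 2 + (ln (expo_mass \<mu>) + \<mu> * \<alpha>) / ln 2 + \<epsilon>"
    using assms by (intro order_tendstoD(2)[OF lim]) simp
  moreover have "\<forall>\<^sub>F A in at_top. 0 < g A"
    using g Zpos by (rule order_tendstoD)
  \<comment> \<open>Once the logarithm is nonnegative, its weight can be bounded by 1.\<close>
  moreover have "\<forall>\<^sub>F A in at_top. 1 \<le> (A / \<sigma>) * g A"
  proof -
    have "filterlim (\<lambda>A. A / \<sigma>) at_top at_top" using assms by real_asymp
    then have "filterlim (\<lambda>A. g A * (A / \<sigma>)) at_top at_top"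
      by (rule filterlim_tendsto_pos_mult_at_top[OF g Zpos])
    then show ?thesis unfolding filterlim_at_top by (simp add: mult.commute)
  qed
  moreover have "\<forall>\<^sub>F A in at_top. (0 :: real) < A" by (rule eventually_gt_at_top)
  ultimately show ?thesis
  proof eventually_elim
    case (elim A)
    let ?p = "1 - Qfun ((sqrt A + \<alpha> * A) / \<sigma>) - Qfun ((sqrt A + (1 - \<alpha>) * A) / \<sigma>)"
    have "c1_obj \<sigma> A \<alpha> \<mu> (sqrt A) = ?p * log 2 ((A / \<sigma>) * g A) + log 2 (exp 1) * r A"
      by (simp only: c1_obj_def g_def r_def times_divide_eq_right)
    also have "?p * log 2 ((A / \<sigma>) * g A) \<le> log 2 ((A / \<sigma>) * g A)"
      using Qfun_nonneg[of "(sqrt A + \<alpha> * A) / \<sigma>"] Qfun_nonneg[of "(sqrt A + (1 - \<alpha>) * A) / \<sigma>"] elim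
      by (intro mult_log2_le) linarith+
    also have "log 2 ((A / \<sigma>) * g A) = log 2 (A / \<sigma>) + log 2 (g A)"
      using elim assms by (subst log_mult) auto
    finally show ?case using elim(1) by linarith
  qed
qed

lemma eventually_c2_obj_le:
  assumes "0 < \<sigma>" "0 < \<epsilon>"
  shows "\<forall>\<^sub>F A in at_top. c2_obj \<sigma> A (sqrt A) \<le> log 2 (A / \<sigma>) - log 2 (2 * pi * exp 1) / 2 + \<epsilon>"
proof -
  define g where "g = (\<lambda>A. (1 + 2 * sqrt A / A) / (sqrt (2 * pi) * (1 - 2 * Qfun (sqrt A / \<sigma>))))"
  define r where "r = (\<lambda>A. - 1 / 2 + Qfun (sqrt A / \<sigma>)
        + sqrt A / (sqrt (2 * pi) * \<sigma>) * exp (- ((sqrt A)\<^sup>2) / (2 * \<sigma>\<^sup>2)))"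
  have Q1: "((\<lambda>A. Qfun (sqrt A / \<sigma>)) \<longlongrightarrow> 0) at_top"
    by (rule filterlim_compose[OF Qfun_tendsto_0]) (use assms in real_asymp)
  have n: "((\<lambda>A :: real. 1 + 2 * sqrt A / A) \<longlongrightarrow> 1) at_top"
    by real_asymp
  have "(g \<longlongrightarrow> 1 / (sqrt (2 * pi) * (1 - 2 * 0))) at_top"
    unfolding g_def using assms by (intro tendsto_intros n Q1) auto
  then have g: "(g \<longlongrightarrow> 1 / sqrt (2 * pi)) at_top" by simp
  have Zpos: "0 < 1 / sqrt (2 * pi)" by simp
  have r1: "((\<lambda>A. sqrt A / (sqrt (2 * pi) * \<sigma>) * exp (- ((sqrt A)\<^sup>2) / (2 * \<sigma>\<^sup>2))) \<longlongrightarrow> 0) at_top"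
    using assms by real_asymp
  have r: "(r \<longlongrightarrow> - 1 / 2 + 0 + 0) at_top"
    unfolding r_def by (intro tendsto_intros Q1 r1)
  have lim: "((\<lambda>A. log 2 (g A) + log 2 (exp 1) * r A) \<longlongrightarrow>
      log 2 (1 / sqrt (2 * pi)) + log 2 (exp 1) * (- 1 / 2 + 0 + 0)) at_top"
    using Zpos by (intro tendsto_intros g r) auto
  have "log 2 (1 / sqrt (2 * pi)) + log 2 (exp 1) * (- 1 / 2 + 0 + 0) = - log 2 (2 * pi * exp 1) / 2"
    by (simp add: log_def ln_div ln_mult ln_sqrt field_simps)
  with lim have "\<forall>\<^sub>F A in at_top. log 2 (g A) + log 2 (exp 1) * r A < - log 2 (2 * pi * exp 1) / 2 + \<epsilon>"
    using assms by (intro order_tendstoD(2)[OF lim]) simp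
  moreover have "\<forall>\<^sub>F A in at_top. 0 < g A"
    using g Zpos by (rule order_tendstoD)
  moreover have "\<forall>\<^sub>F A in at_top. 1 \<le> (A / \<sigma>) * g A"
  proof -
    have "filterlim (\<lambda>A. A / \<sigma>) at_top at_top" using assms by real_asymp
    then have "filterlim (\<lambda>A. g A * (A / \<sigma>)) at_top at_top"
      by (rule filterlim_tendsto_pos_mult_at_top[OF g Zpos])
    then show ?thesis unfolding filterlim_at_top by (simp add: mult.commute)
  qed
  moreover have "\<forall>\<^sub>F A in at_top. (0 :: real) < A" by (rule eventually_gt_at_top)
  ultimately show ?thesis
  proof eventually_elim
    case (elim A)
    let ?p = "1 - 2 * Qfun ((sqrt A + A / 2) / \<sigma>)"
    have arg: "(A + 2 * sqrt A) / (\<sigma> * sqrt (2 * pi) * (1 - 2 * Qfun (sqrt A / \<sigma>))) = (A / \<sigma>) * g A"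
    proof -
      have "(A / \<sigma>) * (1 + 2 * sqrt A / A) = (A + 2 * sqrt A) / \<sigma>"
        using elim by (simp add: distrib_left add_divide_distrib)
      then show ?thesis
        by (simp only: g_def times_divide_eq_right divide_divide_eq_left mult.assoc)
    qed
    have "c2_obj \<sigma> A (sqrt A) = ?p * log 2 ((A / \<sigma>) * g A) + log 2 (exp 1) * r A"
      by (simp only: c2_obj_def arg r_def)
    also have "?p * log 2 ((A / \<sigma>) * g A) \<le> log 2 ((A / \<sigma>) * g A)"
      using Qfun_nonneg elim by (intro mult_log2_le) auto
    also have "log 2 ((A / \<sigma>) * g A) = log 2 (A / \<sigma>) + log 2 (g A)"
      using elim assms by (subst log_mult) auto
    finally show ?case using elim(1) by linarith
  qed
qed

text \<open>The mean tends to \<open>1 / 2\<close> as the tilt tends to 0 and stays below the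
  reciprocal of the tilt, so the intermediate value theorem yields a solution at or below
  \<open>1 / t\<close>. This location is the bound \<open>\<mu> * t \<le> 1\<close>.\<close>

lemma ex_expo_mean_eq:
  assumes "0 < t" "t < 1 / 2"
  shows "\<exists>\<mu>>0. \<mu> * t \<le> 1 \<and> expo_mean \<mu> = t"
proof -
  have "(expo_mean \<longlongrightarrow> 1 / 2) (at_right 0)"
    unfolding expo_mean_def[abs_def] by real_asymp
  then have "\<forall>\<^sub>F \<mu> in at_right 0. t < expo_mean \<mu> \<and> 0 < \<mu>"
    using assms by (intro eventually_conj order_tendstoD(1) eventually_at_right_less) auto
  then obtain l where l: "0 < l" "t < expo_mean l"
    using eventually_happens'[OF trivial_limit_at_right_real] by blast
  have below: "expo_mean \<mu> < 1 / \<mu>" if "0 < \<mu>" for \<mu>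
    using that by (simp add: expo_mean_def)
  have "1 / l > t" using l below by (meson order.strict_trans)
  then have lu: "l \<le> 1 / t" using l assms by (simp add: field_simps)
  have u: "expo_mean (1 / t) < t" using below[of "1 / t"] assms by simp
  have "continuous_on {l..1 / t} expo_mean"
    unfolding expo_mean_def[abs_def] using l by (intro continuous_intros) auto
  then obtain \<mu> where "l \<le> \<mu>" "\<mu> \<le> 1 / t" "expo_mean \<mu> = t"
    using IVT2'[of expo_mean "1 / t" t l] l u lu by auto
  then show ?thesis using l assms by (intro exI[of _ \<mu>]) (auto simp: field_simps)
qed

text \<open>Equivalent to \<open>sinh (\<mu> / 2) \<ge> \<mu> / 2\<close>. For \<alpha> at least
  \<open>1 / 2\<close> it shows that a truncated exponential law of mean just below
  \<open>1 / 2\<close> nearly reaches the volume rate of the uniform law.\<close>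

lemma ln_expo_mass_ge:
  assumes "0 < \<mu>"
  shows "- \<mu> / 2 \<le> ln (expo_mass \<mu>)"
proof -
  have "\<mu> \<le> exp (\<mu> / 2) - exp (- \<mu> / 2)"
    using real_le_x_sinh[of "\<mu> / 2"] assms by (simp add: exp_minus)
  then have "exp (- \<mu> / 2) * \<mu> \<le> exp (- \<mu> / 2) * (exp (\<mu> / 2) - exp (- \<mu> / 2))"
    by (intro mult_left_mono) auto
  also have "\<dots> = 1 - exp (- \<mu>)"
    by (simp add: right_diff_distrib exp_add[symmetric])
  finally have "exp (- \<mu> / 2) \<le> expo_mass \<mu>"
    using assms by (simp add: expo_mass_def field_simps)
  then show ?thesis using expo_mass_pos[OF assms] by (simp add: ln_ge_iff)
qed

text \<open>One constant \<Lambda> governs both sides: within \<epsilon> it bounds the offset of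
  \<open>Cbar\<close> from above and the exponential growth rate of the admissible volume from
  below. The same tilt \<mu> is used in both estimates.\<close>

lemma ex_rate_constant:
  assumes "0 < \<sigma>" "0 < \<alpha>" "\<alpha> \<le> 1" "0 < \<epsilon>"
  shows "\<exists>\<Lambda>. (\<forall>\<^sub>F A in at_top. Cbar \<sigma> A \<alpha> \<le> log 2 (A / \<sigma>) - log 2 (2 * pi * exp 1) / 2 + \<Lambda> + \<epsilon>)
    \<and> (\<forall>A>0. \<forall>\<^sub>F n in sequentially. (A * 2 powr (\<Lambda> - \<epsilon>)) ^ n / 2
        \<le> measure (PiM {..<n} (\<lambda>_. lborel)) (cost_ball n \<alpha> A))"
proof -
  define \<alpha>0 where "\<alpha>0 = min \<alpha> (1 / 2)"
  \<comment> \<open>The first bound keeps the mean \<open>t\<close> at least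
    \<open>\<alpha>0 / 2\<close>, whence \<mu> is at most \<open>2 / \<alpha>0\<close>; the second
    then keeps the loss \<open>2 * \<mu> * \<delta>\<close> below \<open>\<epsilon> * ln 2\<close>.
    One \<delta> of this loss comes from the choice of \<open>t\<close>, the other from the
    concentration margin.\<close>
  define \<delta> where "\<delta> = min (\<alpha>0 / 4) (\<epsilon> * ln 2 * \<alpha>0 / 8)"
  define t where "t = \<alpha>0 - \<delta>"
  have \<alpha>0: "0 < \<alpha>0" "\<alpha>0 \<le> \<alpha>" "\<alpha>0 \<le> 1 / 2" using assms by (auto simp: \<alpha>0_def)
  have \<delta>: "0 < \<delta>" "\<delta> \<le> \<alpha>0 / 4" "\<delta> \<le> \<epsilon> * ln 2 * \<alpha>0 / 8" using \<alpha>0 assms by (auto simp: \<delta>_def)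
  have t: "\<alpha>0 / 2 \<le> t" "0 < t" "t < 1 / 2" using \<alpha>0 \<delta> by (auto simp: t_def)
  obtain \<mu> where \<mu>: "0 < \<mu>" "\<mu> * t \<le> 1" "expo_mean \<mu> = t" using ex_expo_mean_eq t by blast
  have "\<mu> * (\<alpha>0 / 2) \<le> 1" using \<mu> t by (meson less_imp_le mult_left_mono order_trans)
  then have "\<epsilon> * ln 2 / 4 * (\<mu> * (\<alpha>0 / 2)) \<le> \<epsilon> * ln 2 / 4 * 1"
    using assms by (intro mult_left_mono) auto
  moreover have "\<mu> * \<delta> \<le> \<mu> * (\<epsilon> * ln 2 * \<alpha>0 / 8)" using \<mu> \<delta> by (intro mult_left_mono) auto
  ultimately have "\<mu> * \<delta> \<le> \<epsilon> * ln 2 / 4" by (simp add: algebra_simps)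
  moreover have "0 < \<epsilon> * ln 2" using assms by simp
  ultimately have loss: "2 * (\<mu> * \<delta>) \<le> \<epsilon> * ln 2" by linarith
  \<comment> \<open>These are the offsets in the limits of the two objectives; 0 is the entropy of
    the uniform law on the unit interval.\<close>
  define \<Lambda> where "\<Lambda> = (if \<alpha> < 1 / 2 then (ln (expo_mass \<mu>) + \<mu> * \<alpha>) / ln 2 else 0)"
  have upper: "\<forall>\<^sub>F A in at_top. Cbar \<sigma> A \<alpha> \<le> log 2 (A / \<sigma>) - log 2 (2 * pi * exp 1) / 2 + \<Lambda> + \<epsilon>"
  proof (cases "\<alpha> < 1 / 2")
    case True
    show ?thesis
      using eventually_c1_obj_le[OF assms(1) \<mu>(1) assms(4), of \<alpha>] eventually_gt_at_top[of 0]
    proof eventually_elim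
      case (elim A)
      then have "Cbar \<sigma> A \<alpha> \<le> c1_obj \<sigma> A \<alpha> \<mu> (sqrt A)"
        using True assms \<mu> by (intro Cbar_le_c1_obj) auto
      with elim True show ?case by (simp add: \<Lambda>_def)
    qed
  next
    case False
    show ?thesis
      using eventually_c2_obj_le[OF assms(1,4)] eventually_gt_at_top[of 0]
    proof eventually_elim
      case (elim A)
      then have "Cbar \<sigma> A \<alpha> \<le> c2_obj \<sigma> A (sqrt A)"
        using False assms by (intro Cbar_le_c2_obj) auto
      with elim False show ?case by (simp add: \<Lambda>_def)
    qed
  qed
  have density: "2 powr (\<Lambda> - \<epsilon>) \<le> expo_mass \<mu> * exp (\<mu> * (expo_mean \<mu> - \<delta>))"
  proof -
    have "(\<Lambda> - \<epsilon>) * ln 2 \<le> ln (expo_mass \<mu>) + \<mu> * (t - \<delta>)"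
    proof (cases "\<alpha> < 1 / 2")
      case True
      then have "\<alpha> = t + \<delta>" by (simp add: t_def \<alpha>0_def)
      moreover have "\<Lambda> * ln 2 = ln (expo_mass \<mu>) + \<mu> * \<alpha>" using True by (simp add: \<Lambda>_def)
      ultimately show ?thesis using loss by (simp add: left_diff_distrib) (simp add: algebra_simps)
    next
      case False
      then have "t = 1 / 2 - \<delta>" by (simp add: t_def \<alpha>0_def)
      then have "\<mu> * (t - \<delta>) = \<mu> / 2 - 2 * (\<mu> * \<delta>)" by (simp only:) (simp add: algebra_simps)
      then show ?thesis using False loss ln_expo_mass_ge[OF \<mu>(1)] by (simp add: \<Lambda>_def)
    qed
    then have "2 powr (\<Lambda> - \<epsilon>) \<le> exp (ln (expo_mass \<mu>) + \<mu> * (t - \<delta>))"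
      by (simp add: powr_def)
    also have "\<dots> = expo_mass \<mu> * exp (\<mu> * (t - \<delta>))"
      using expo_mass_pos[OF \<mu>(1)] by (simp add: exp_add)
    finally show ?thesis using \<mu> by simp
  qed
  have lower: "\<forall>\<^sub>F n in sequentially. (A * 2 powr (\<Lambda> - \<epsilon>)) ^ n / 2
        \<le> measure (PiM {..<n} (\<lambda>_. lborel)) (cost_ball n \<alpha> A)" if "0 < A" for A
  proof -
    have "expo_mean \<mu> + \<delta> \<le> \<alpha>" using \<mu>(3) \<alpha>0(2) by (simp add: t_def)
    from eventually_cost_ball_volume[OF that \<mu>(1) \<delta>(1) this] show ?thesis
    proof eventually_elim
      case (elim n)
      have "(A * 2 powr (\<Lambda> - \<epsilon>)) ^ n / 2 \<le> (A * (expo_mass \<mu> * exp (\<mu> * (expo_mean \<mu> - \<delta>)))) ^ n / 2"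
        using density that by (intro divide_right_mono power_mono mult_left_mono) auto
      with elim show ?case by linarith
    qed
  qed
  from upper lower show ?thesis by blast
qed

section \<open>Rate inequalities and the achievable pair\<close>

lemma rate_less_imp:
  assumes "0 < \<sigma>" "0 < h" "0 < A" "R < log 2 (h * A / \<sigma>) - log 2 (2 * pi * exp 1) / 2 + L"
  shows "2 powr R * sqrt (2 * pi * exp 1 * \<sigma>\<^sup>2) < h * (A * 2 powr L)"
proof -
  have "2 powr R < 2 powr (log 2 (h * A / \<sigma>) - log 2 (2 * pi * exp 1) / 2 + L)"
    using assms by simp
  also have "\<dots> = (h * A / \<sigma>) / sqrt (2 * pi * exp 1) * 2 powr L"
  proof -
    have "2 powr (log 2 (2 * pi * exp 1) / 2) = (2 powr log 2 (2 * pi * exp 1)) powr (1 / 2)"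
      by (simp only: powr_powr) simp
    also have "\<dots> = sqrt (2 * pi * exp 1)"
      by (simp add: powr_half_sqrt)
    finally show ?thesis
      using assms by (simp only: powr_add powr_diff) simp
  qed
  finally show ?thesis
    using assms by (simp add: real_sqrt_mult field_simps)
qed

text \<open>The squared gain ratio is at least 1, so the logarithm is nonnegative and the minimum is
  0.\<close>

lemma sum_bound_strong:
  assumes "0 < hjj" "hjj \<le> hji"
  shows "sum_bound \<sigma> A \<alpha> hii hji hjj = Cbar \<sigma> ((hii + hji) * A) \<alpha>"
proof -
  have "hjj\<^sup>2 \<le> hji\<^sup>2" using assms by (intro power_mono) auto
  then have "1 \<le> hji\<^sup>2 / hjj\<^sup>2" using assms by simp
  then have "0 \<le> log 2 (max (hji\<^sup>2 / hjj\<^sup>2) x)" for x by (intro zero_le_log_cancel_iff[THEN iffD2]) auto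
  then show ?thesis unfolding sum_bound_def by (simp add: min_def)
qed

theorem theorem5:
  fixes \<sigma> \<alpha> h11 h12 h21 h22 :: real
  assumes "\<sigma> > 0"
    and "0 < \<alpha>" and "\<alpha> \<le> 1"
    and "0 < h11" and "h11 \<le> h12"
    and "0 < h22" and "h22 \<le> h21"
  shows "\<forall>\<epsilon>>0. \<exists>T. \<forall>A>0. A / \<sigma> \<ge> T \<longrightarrow>
           (\<forall>(R1, R2) \<in> GZ' \<sigma> A \<alpha> h11 h12 h21 h22.
              in_cap_region \<sigma> A \<alpha> \<alpha> h11 h12 h21 h22 (R1 - 1/2 - \<epsilon>) (R2 - 1/2 - \<epsilon>))"
proof (intro allI impI)
  fix \<epsilon> :: real assume \<epsilon>: "0 < \<epsilon>"
  \<comment> \<open>The estimate of \<open>Cbar\<close> and the volume bound cost one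
    \<open>e\<close> each, so \<epsilon> exceeds the total of \<open>2 * e\<close> and leaves room
    for strict inequalities.\<close>
  define e where "e = \<epsilon> / 4"
  have e: "0 < e" "\<epsilon> = 4 * e" using \<epsilon> by (auto simp: e_def)
  have h: "0 < h12" "0 < h21" using assms by auto
  obtain \<Lambda> where Cbar: "\<forall>\<^sub>F A in at_top. Cbar \<sigma> A \<alpha> \<le> log 2 (A / \<sigma>) - log 2 (2 * pi * exp 1) / 2 + \<Lambda> + e"
    and vol: "\<And>A. 0 < A \<Longrightarrow> \<forall>\<^sub>F n in sequentially. (A * 2 powr (\<Lambda> - e)) ^ n / 2
        \<le> measure (PiM {..<n} (\<lambda>_. lborel)) (cost_ball n \<alpha> A)"
    using ex_rate_constant[OF assms(1-3) e(1)] by blast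
  \<comment> \<open>The logarithm of \<open>h * A * 2 powr (\<Lambda> - e)\<close> over
    \<open>\<sigma> * sqrt (2 * pi * exp 1)\<close>: the rate that the volume bound supports at gain
    \<open>h\<close>.\<close>
  define S where "S = (\<lambda>A h. log 2 (h * A / \<sigma>) - log 2 (2 * pi * exp 1) / 2 + (\<Lambda> - e))"
  have C: "\<forall>\<^sub>F A in at_top. Cbar \<sigma> (h * A) \<alpha> \<le> S A h + 2 * e" if "0 < h" for h
  proof -
    have "filterlim (\<lambda>A. h * A) at_top at_top" using that by real_asymp
    from eventually_compose_filterlim[OF Cbar this] show ?thesis
      by eventually_elim (simp add: S_def)
  qed
  \<comment> \<open>Positivity covers rates that are truncated to 0 below.\<close>
  have pos: "\<forall>\<^sub>F A in at_top. 0 < S A h" if "0 < h" for h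
  proof -
    have "filterlim (\<lambda>A. S A h) at_top at_top"
      unfolding S_def log_def using that assms(1) by real_asymp
    then show ?thesis by (simp add: filterlim_at_top_dense)
  qed
  have "\<forall>\<^sub>F A in at_top. 0 < S A h11 \<and> 0 < S A h22 \<and> Cbar \<sigma> (h11 * A) \<alpha> \<le> S A h11 + 2 * e
    \<and> Cbar \<sigma> (h22 * A) \<alpha> \<le> S A h22 + 2 * e \<and> Cbar \<sigma> ((h11 + h21) * A) \<alpha> \<le> S A (h11 + h21) + 2 * e
    \<and> Cbar \<sigma> ((h22 + h12) * A) \<alpha> \<le> S A (h22 + h12) + 2 * e"
    using assms h by (intro eventually_conj C pos) auto
  then obtain N where N: "\<And>A. N \<le> A \<Longrightarrow> 0 < S A h11 \<and> 0 < S A h22 \<and> Cbar \<sigma> (h11 * A) \<alpha> \<le> S A h11 + 2 * e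
    \<and> Cbar \<sigma> (h22 * A) \<alpha> \<le> S A h22 + 2 * e \<and> Cbar \<sigma> ((h11 + h21) * A) \<alpha> \<le> S A (h11 + h21) + 2 * e
    \<and> Cbar \<sigma> ((h22 + h12) * A) \<alpha> \<le> S A (h22 + h12) + 2 * e"
    unfolding eventually_at_top_linorder by blast
  have "in_cap_region \<sigma> A \<alpha> \<alpha> h11 h12 h21 h22 (R1 - 1/2 - \<epsilon>) (R2 - 1/2 - \<epsilon>)"
    if A: "0 < A" "N / \<sigma> \<le> A / \<sigma>" and R: "(R1, R2) \<in> GZ' \<sigma> A \<alpha> h11 h12 h21 h22" for A R1 R2
  proof -
    have "N \<le> A" using A assms by (simp add: divide_le_cancel)
    note N = N[OF this]
    have R': "R1 \<le> S A h11 + 2 * e" "R2 \<le> S A h22 + 2 * e"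
       "R1 + R2 \<le> S A (h11 + h21) + 2 * e" "R1 + R2 \<le> S A (h22 + h12) + 2 * e"
      using R N assms by (auto simp: GZ'_def sum_bound_strong)
    \<comment> \<open>Achievable pairs in \<open>cap_region\<close> are nonnegative, so negative
      coordinates are replaced by 0 and the target pair is dominated.\<close>
    define Q1 where "Q1 = max 0 (R1 - 1/2 - \<epsilon>)"
    define Q2 where "Q2 = max 0 (R2 - 1/2 - \<epsilon>)"
    have S_mono: "S A x \<le> S A y" if "0 < x" "x \<le> y" for x y
      using that A assms unfolding S_def by (auto intro!: divide_right_mono mult_right_mono)
    \<comment> \<open>The sum of two gains is at most twice the larger one, and doubling the gain
      adds one bit.\<close>
    have S_half: "S A (x + y) \<le> S A (max x y) + 1" if "0 < x" "0 < y" for x y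
    proof -
      have "S A (x + y) \<le> S A (2 * max x y)" using that by (intro S_mono) auto
      also have "\<dots> = S A (max x y) + 1"
      proof -
        have "log 2 (2 * max x y * A / \<sigma>) = log 2 (2 * (max x y * A / \<sigma>))" by (simp add: mult_ac)
        also have "\<dots> = 1 + log 2 (max x y * A / \<sigma>)"
          using that A assms by (subst log_mult) (auto simp: less_max_iff_disj)
        finally show ?thesis by (simp add: S_def)
      qed
      finally show ?thesis .
    qed
    have Q: "Q1 < S A h11" "Q2 < S A h22" using R' N e by (auto simp: Q1_def Q2_def)
    \<comment> \<open>If both rates are positive, subtracting half a bit from each pays for the one
      bit of \<open>S_half\<close>. If one is 0, the other is controlled by its individual bound, as
      the larger gain dominates both direct gains in strong interference.\<close>
    have Q12: "Q1 + Q2 < S A (max x y)"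
      if "R1 + R2 \<le> S A (x + y) + 2 * e" "0 < x" "0 < y" "h11 \<le> max x y" "h22 \<le> max x y" for x y
    proof -
      have "S A h11 \<le> S A (max x y)" "S A h22 \<le> S A (max x y)"
        using that assms by (auto intro!: S_mono)
      with S_half[OF that(2,3)] that(1) Q e N show ?thesis
        by (auto simp: Q1_def Q2_def max_def split: if_splits)
    qed
    have "achievable \<sigma> A \<alpha> \<alpha> h11 h12 h21 h22 Q1 Q2"
      using assms h A Q vol[OF A(1)] R'
      by (intro achievable_of_volume[where V="A * 2 powr (\<Lambda> - e)"])
         (auto intro!: rate_less_imp Q12[unfolded S_def] simp: S_def less_max_iff_disj le_max_iff_disj)
    then have "(Q1, Q2) \<in> cap_region \<sigma> A \<alpha> \<alpha> h11 h12 h21 h22"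
      unfolding cap_region_def by (intro closure_subset[THEN subsetD]) (auto simp: Q1_def Q2_def)
    then show ?thesis
      unfolding in_cap_region_def by (intro bexI[of _ "(Q1, Q2)"]) (auto simp: Q1_def Q2_def)
  qed
  then show "\<exists>T. \<forall>A>0. T \<le> A / \<sigma> \<longrightarrow> (\<forall>(R1, R2) \<in> GZ' \<sigma> A \<alpha> h11 h12 h21 h22.
              in_cap_region \<sigma> A \<alpha> \<alpha> h11 h12 h21 h22 (R1 - 1/2 - \<epsilon>) (R2 - 1/2 - \<epsilon>))"
    by (intro exI[of _ "N / \<sigma>"]) auto
qed

end
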